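(* Let $\mathbf{y} \sim N(\mathbf{X}\boldsymbol{\beta}, \sigma^2(\mathbf{I}_n + \tau^{-1}\mathbf{H}^+))$ be the Gaussian model with intrinsic conditional autoregressive (ICAR) random effects integrated out, where $\mathbf{X}$ is an $n\times p$ regressor matrix of full column rank $p<n$ with one column equal to $\mathbf{1}_n$, $\boldsymbol{\beta}\in\mathbb{R}^p$, $\sigma^2>0$, $\tau>0$, and $\mathbf{H}$ is the neighborhood matrix described in the context. Let $\mathbf{H}=\mathbf{P}\mathbf{D}\mathbf{P}'$ be a spectral decomposition with $\mathbf{P}$ orthogonal and $\mathbf{D}=\mathrm{diag}(d_1,\dots,d_n)$, $d_1\ge\cdots\ge d_{n-1}>d_n=0$. Put $\mathbf{D}^+=\mathrm{diag}(d_1^{-1},\dots,d_{n-1}^{-1},0)$, $\widetilde{\mathbf{X}}=\mathbf{P}'\mathbf{X}$, $\mathbf{B}(\tau)=(\mathbf{I}_n+\tau^{-1}\mathbf{D}^+)^{-1}$, and $\mathbf{Q}_{ij}(\tau)=\widetilde{\mathbf{X}}'\{\mathbf{D}^+\}^{i}\{\mathbf{B}(\tau)\}^{j}\widetilde{\mathbf{X}}$ for nonnegative integers $i,j$ (with $\{\mathbf{D}^+\}^0=\mathbf{I}_n$). Then the reference prior of $(\boldsymbol{\beta},\sigma^2,\tau)$ is of the form $\pi(\boldsymbol{\beta},\sigma^2,\tau)\propto \sigma^{-2}\pi(\tau)$, where $$ \begin{aligned} \pi(\tau) \propto \tau^{-2}\Big\{ & \mathrm{tr}\big((\mathbf{D}^+\mathbf{B}(\tau))^2\big)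 + \mathrm{tr}\big((\{\mathbf{Q}_{01}(\tau)\}^{-1}\mathbf{Q}_{12}(\tau))^2\big) - 2\,\mathrm{tr}\big(\{\mathbf{Q}_{01}(\tau)\}^{-1}\mathbf{Q}_{23}(\tau)\big) \\ & - \frac{1}{n-p}\big[\mathrm{tr}(\{\mathbf{Q}_{01}(\tau)\}^{-1}\mathbf{Q}_{12}(\tau)) - \mathrm{tr}(\mathbf{D}^+\mathbf{B}(\tau))\big]^2 \Big\}^{1/2}. \end{aligned} $$ Here $\propto$ means equality up to a positive constant not depending on $(\boldsymbol{\beta},\sigma^2,\tau)$.
   Context: Neighborhood matrix. A region is partitioned into $n$ subregions; $N_j$ is the set of neighbors of subregion $j$ (a symmetric relation, $j\notin N_j$). Similarity weights satisfy $g_{ij}=g_{ji}\ge 0$, with $g_{ij}=0$ when $i\ne j$ are not neighbors. The symmetric $n\times n$ matrix $\mathbf{H}$ has entries $(\mathbf{H})_{ii}=h_i=\sum_{j\neq i}g_{ij}$, $(\mathbf{H})_{ij}=-g_{ij}$ if $i\in N_j$, and $0$ otherwise. Thus $\mathbf{H}$ is positive semidefinite and $\mathbf{H}\mathbf{1}_n=\mathbf{0}$. It is assumed that any two subregions are connected by a path, so that the null eigenvalue of $\mathbf{H}$ has multiplicity one. $\mathbf{H}^+=\mathbf{P}\mathbf{D}^+\mathbf{P}'$ is the Moore-Penrose inverse of $\mathbf{H}$. Primes denote transposes. Model. The underlying hierarchical model is $\mathbf{y}=\mathbf{X}\boldsymbol{\beta}+\boldsymbol{\phi}+\boldsymbol{\epsilon}$,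 with independent $\boldsymbol{\epsilon}\sim N(\mathbf{0},\sigma^2\mathbf{I}_n)$ and $\boldsymbol{\phi}\sim N(\mathbf{0},\tau^{-1}\sigma^2\mathbf{H}^+)$ (a singular Gaussian, supported on $\mathbf{1}_n'\boldsymbol{\phi}=0$). Integrating out $\boldsymbol{\phi}$ gives $\mathbf{y}\sim N(\mathbf{X}\boldsymbol{\beta},\sigma^2(\mathbf{I}_n+\tau^{-1}\mathbf{H}^+))$. Reference prior. "The reference prior" is meant in the sense of Berger, De Oliveira and Sansó (2001), with $(\sigma^2,\tau)$ as parameters of interest and $\boldsymbol{\beta}$ as nuisance parameter: $\pi(\boldsymbol{\beta},\sigma^2,\tau)=\pi(\boldsymbol{\beta}\mid\sigma^2,\tau)\,\pi(\sigma^2,\tau)$, where $\pi(\boldsymbol{\beta}\mid\sigma^2,\tau)=1$ and $\pi(\sigma^2,\tau)\propto\{\det \mathbf{I}(\sigma^2,\tau)\}^{1/2}$ is the Jeffreys-rule prior computed from the integrated likelihood $L^I(\sigma^2,\tau;\mathbf{y})=\int_{\mathbb{R}^p}p(\mathbf{y}\mid\boldsymbol{\beta},\sigma^2,\tau)\,d\boldsymbol{\beta}$. Here $p(\mathbf{y}\mid\boldsymbol{\beta},\sigma^2,\tau)$ is the Gaussian density of the model, and $\mathbf{I}(\sigma^2,\tau)$ is the $2\times 2$ Fisher information matrix of $\log L^I$ with respect to $(\sigma^2,\tau)$, i.e. the expectation of minus the Hessian of $\log L^I$ under $\mathbf{y}\sim N(\mathbf{X}\boldsymbol{\beta},\sigma^2(\mathbf{I}_n+\tau^{-1}\mathbf{H}^+))$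 (this expectation does not depend on $\boldsymbol{\beta}$). *)

theory Defs
  imports "HOL-Analysis.Analysis"
begin

definition diag_matrix :: "('n \<Rightarrow> real) \<Rightarrow> real^'n^'n" where
  "diag_matrix d = (\<chi> i j. if i = j then d i else 0)"

text \<open>The overloaded power on vectors is taken componentwise, so powers with respect to the
  matrix product need their own function.\<close>

primrec matrix_pow :: "real^'n^'n \<Rightarrow> nat \<Rightarrow> real^'n^'n" where
  "matrix_pow A 0 = mat 1"
| "matrix_pow A (Suc k) = A ** matrix_pow A k"

text \<open>The four Penrose conditions; they determine \<open>G\<close> uniquely.\<close>

definition is_moore_penrose_inverse :: "real^'n^'m \<Rightarrow> real^'m^'n \<Rightarrow> bool" where
  "is_moore_penrose_inverse A G \<longleftrightarrow>
     A ** G ** A = A \<and> G ** A ** G = G \<and>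
     transpose (A ** G) = A ** G \<and> transpose (G ** A) = G ** A"

definition neighborhood_matrix :: "('n \<Rightarrow> 'n set) \<Rightarrow> ('n \<Rightarrow> 'n \<Rightarrow> real) \<Rightarrow> real^'n^'n" where
  "neighborhood_matrix N g =
     (\<chi> i j. if i = j then (\<Sum>k\<in>UNIV - {i}. g i k) else if i \<in> N j then - g i j else 0)"

definition gaussian_density :: "real^'n \<Rightarrow> real^'n^'n \<Rightarrow> real^'n \<Rightarrow> real" where
  "gaussian_density \<mu> S y =
     exp (- ((y - \<mu>) \<bullet> (matrix_inv S *v (y - \<mu>))) / 2) / sqrt ((2 * pi) ^ CARD('n) * det S)"

text \<open>The parameters of interest are \<open>\<theta> = (\<sigma>\<^sup>2, \<tau>)\<close>; in particular \<open>\<theta> $ 1\<close> is the variance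
  and derivatives are taken with respect to it, not with respect to \<open>\<sigma>\<close>. The argument \<open>G\<close> is the
  Moore-Penrose inverse of the neighborhood matrix.\<close>

definition icar_density ::
    "real^'p^'n \<Rightarrow> real^'n^'n \<Rightarrow> real^'p \<Rightarrow> real^2 \<Rightarrow> real^'n \<Rightarrow> real" where
  "icar_density X G \<beta> \<theta> =
     gaussian_density (X *v \<beta>) ((\<theta> $ 1) *\<^sub>R (mat 1 + (1 / \<theta> $ 2) *\<^sub>R G))"

definition has_hessian :: "(real^'k \<Rightarrow> real) \<Rightarrow> real^'k^'k \<Rightarrow> real^'k \<Rightarrow> bool" where
  "has_hessian f A \<theta> \<longleftrightarrow>
     (\<exists>g. (\<forall>\<^sub>F z in nhds \<theta>. GDERIV f z :> g z) \<and> (g has_derivative (\<lambda>h. A *v h)) (at \<theta>))"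

text \<open>\<open>\<l> z y\<close> is the log-likelihood at the parameter value \<open>z\<close> and the observation \<open>y\<close>, and \<open>M\<close> is
  the distribution of the observation: \<open>J\<close> is the expectation of minus the Hessian.\<close>

definition has_fisher_information ::
    "(real^'k \<Rightarrow> 'y \<Rightarrow> real) \<Rightarrow> 'y measure \<Rightarrow> real^'k^'k \<Rightarrow> real^'k \<Rightarrow> bool" where
  "has_fisher_information \<l> M J \<theta> \<longleftrightarrow>
     (\<exists>A. (\<forall>y. has_hessian (\<lambda>z. \<l> z y) (A y) \<theta>) \<and> has_bochner_integral M (\<lambda>y. - A y) J)"

definition integrated_likelihood ::
    "('b::euclidean_space \<Rightarrow> 't \<Rightarrow> 'y \<Rightarrow> real) \<Rightarrow> 't \<Rightarrow> 'y \<Rightarrow> real" where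
  "integrated_likelihood p \<theta> y = (\<integral>\<beta>. p \<beta> \<theta> y \<partial>lborel)"

text \<open>Reference prior in the sense of Berger, De Oliveira and Sanso (2001) for a family of
  densities \<open>p \<beta> \<theta>\<close>, with parameter of interest \<open>\<theta> \<in> \<Theta>\<close> and nuisance parameter \<open>\<beta>\<close>: the
  conditional prior of \<open>\<beta>\<close> given \<open>\<theta>\<close> is \<open>1\<close> and the marginal prior of \<open>\<theta>\<close> is the Jeffreys-rule
  prior of the integrated likelihood. Existence of the integrals and of the Hessians, and the
  independence of the information matrix \<open>J\<close> from \<open>\<beta>\<close>, are part of the notion. It is determined
  only up to a positive constant \<open>c\<close>.\<close>

definition is_reference_prior ::
    "(real^'k) set \<Rightarrow> ('b::euclidean_space \<Rightarrow> real^'k \<Rightarrow> 'y::euclidean_space \<Rightarrow> real) \<Rightarrow>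
     ('b \<Rightarrow> real^'k \<Rightarrow> real) \<Rightarrow> bool" where
  "is_reference_prior \<Theta> p \<pi> \<longleftrightarrow>
     (\<forall>\<theta>\<in>\<Theta>. \<forall>y. integrable lborel (\<lambda>\<beta>. p \<beta> \<theta> y)) \<and>
     (\<exists>J. (\<forall>\<theta>\<in>\<Theta>. \<forall>\<beta>.
             has_fisher_information (\<lambda>z y. ln (integrated_likelihood p z y))
               (density lborel (\<lambda>y. ennreal (p \<beta> \<theta> y))) (J \<theta>) \<theta>) \<and>
          (\<exists>c>0. \<forall>\<beta>. \<forall>\<theta>\<in>\<Theta>. \<pi> \<beta> \<theta> = 1 * (c * sqrt (det (J \<theta>)))))"

end

(* The integrated likelihood is Gaussian in closed form: with W = (I + G/t)^-1, G = H^+, and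
   R = W - W X (X'WX)^-1 X'W one gets, up to a constant,
     log L = -(n-p)/2 log v - 1/2 log det (I + G/t) - 1/2 log det (X'WX) - y'Ry/(2v).
   Since R satisfies the resolvent identity R(s) - R(t) = (1/t - 1/s) R(s) G R(t), its derivative
   is R G R / t^2, and Jacobi's formula gives tr(GR)/(2t^2) as the derivative of the two
   determinant terms.  Because R annihilates the columns of X and R (I + G/t) R = R, the
   expectation of minus the Hessian involves only tr(GR) and tr(GRGR), which the spectral
   decomposition turns into the traces of the theorem. *)

theory Submission
  imports Defs "HOL-Probability.Distributions"
begin

subsection \<open>Linear change of variables\<close>

text \<open>Why R and not W: differentiation in t stays inside words in G and R, each derivative of
  R inserting one more factor GR. Thus tr(GR) has derivative tr(GRGR)/t^2, and the terms in
  tr(GR)/t^3 cancel in the expected second derivative. R is singular, so its resolvent identity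
  cannot come from inverting it; it comes from R(s) C(s) R(t) = R(t) and R(s) C(t) R(t) = R(s) with
  C(t) = I + G/t. With m = n - p, the determinant of the information is m / (4 v^2 t^4) times
  (tr(GRGR) - tr(GR)^2 / m). This is the source of the factors 1/v and 1/t^2 and of 1/(n-p); the
  remaining constant sqrt(m)/2 is absorbed by proportionality. The notion of reference prior
  includes existence of all integrals and Hessians, so integrals are proved as
  \<open>has_bochner_integral\<close> facts, by standardizing each Gaussian with an explicit factor
  L of its covariance LL'. The result is an equivalence, so the information matrix must also be
  shown to be unique.\<close>

lemma borel_measurable_matrix_vector_mult [measurable]:
  fixes A :: "real^'n^'m"
  shows "(*v) A \<in> borel_measurable borel"
  by (intro borel_measurable_continuous_onI matrix_vector_mult_linear_continuous_on)

lemma prod_Basis_cart: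
  fixes f :: "real^'n \<Rightarrow> 'a::comm_monoid_mult"
  shows "prod f Basis = (\<Prod>i\<in>UNIV. f (axis i 1))"
proof -
  have "Basis = range (\<lambda>i::'n. axis i (1::real))"
    by (auto simp: Basis_vec_def)
  moreover have "inj (\<lambda>i::'n. axis i (1::real))"
    by (auto simp: inj_on_def axis_eq_axis)
  then have "prod f (range (\<lambda>i. axis i 1)) = (\<Prod>i\<in>UNIV. f (axis i 1))"
    by (subst prod.reindex) (simp_all add: o_def)
  ultimately show ?thesis
    by simp
qed

text \<open>By Tonelli, coordinate \<open>m\<close> can be integrated first. There the shear is a
  translation by coordinate \<open>n\<close>, which stays fixed because \<open>m \<noteq> n\<close>,
  and one-dimensional Lebesgue measure is translation invariant.\<close>

lemma nn_integral_lborel_shear: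
  fixes F :: "real^'n \<Rightarrow> ennreal"
  assumes [measurable]: "F \<in> borel_measurable borel" and "m \<noteq> n"
  shows "(\<integral>\<^sup>+x. F (x + x $ n *\<^sub>R axis m 1) \<partial>lborel) = (\<integral>\<^sup>+x. F x \<partial>lborel)"
proof -
  interpret product_sigma_finite "\<lambda>_::real^'n. lborel::real measure"
    by standard
  let ?b = "axis m 1 :: real^'n" and ?c = "axis n 1 :: real^'n"
  let ?I = "Basis - {?b}"
  let ?T = "\<lambda>f. \<Sum>b\<in>Basis. f b *\<^sub>R b :: real^'n"
  have c: "?c \<in> Basis" "?c \<noteq> ?b"
    using \<open>m \<noteq> n\<close> by (auto simp: axis_eq_axis axis_in_Basis_iff)
  have B: "insert ?b ?I = Basis"
    by (auto simp: axis_in_Basis_iff)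
  have split: "(\<integral>\<^sup>+x. K x \<partial>lborel)
      = (\<integral>\<^sup>+f. (\<integral>\<^sup>+y. K (?T (f(?b := y))) \<partial>lborel) \<partial>(\<Pi>\<^sub>M b\<in>?I. lborel))"
    if [measurable]: "K \<in> borel_measurable borel" for K :: "real^'n \<Rightarrow> ennreal"
  proof -
    have "(\<integral>\<^sup>+x. K x \<partial>lborel) = (\<integral>\<^sup>+f. K (?T f) \<partial>(\<Pi>\<^sub>M b\<in>insert ?b ?I. lborel))"
      unfolding B by (subst lborel_eq) (simp add: nn_integral_distr)
    also have "\<dots> = (\<integral>\<^sup>+f. (\<integral>\<^sup>+y. K (?T (f(?b := y))) \<partial>lborel) \<partial>(\<Pi>\<^sub>M b\<in>?I. lborel))"
    proof (rule product_nn_integral_insert)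
      show "(\<lambda>f. K (?T f)) \<in> borel_measurable (\<Pi>\<^sub>M b\<in>insert ?b ?I. lborel)"
        unfolding B by measurable
    qed auto
    finally show ?thesis .
  qed
  \<comment> \<open>The factor \<open>1 * y\<close> gives the integrand the shape of the affine
    substitution rule \<open>nn_integral_real_affine\<close>.\<close>
  have upd: "?T (f(?b := y)) + ?T (f(?b := y)) $ n *\<^sub>R ?b = ?T (f(?b := f ?c + 1 * y))" for f y
  proof -
    have 1: "?T (f(?b := z)) = z *\<^sub>R ?b + (\<Sum>b\<in>?I. f b *\<^sub>R b)" for z
      by (subst B [symmetric], subst sum.insert) (auto intro!: sum.cong)
    have "?T (f(?b := y)) $ n = ?T (f(?b := y)) \<bullet> ?c"
      by (simp add: inner_axis)
    also have "\<dots> = f ?c"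
      using c by (subst inner_sum_left_Basis) auto
    finally show ?thesis
      unfolding 1 by (simp add: algebra_simps)
  qed
  have "(\<integral>\<^sup>+x. F (x + x $ n *\<^sub>R ?b) \<partial>lborel)
      = (\<integral>\<^sup>+f. (\<integral>\<^sup>+y. F (?T (f(?b := f ?c + 1 * y))) \<partial>lborel) \<partial>(\<Pi>\<^sub>M b\<in>?I. lborel))"
    by (subst split) (simp_all only: upd, measurable)
  also have "\<dots> = (\<integral>\<^sup>+f. (\<integral>\<^sup>+y. F (?T (f(?b := y))) \<partial>lborel) \<partial>(\<Pi>\<^sub>M b\<in>?I. lborel))"
  proof (rule nn_integral_cong)
    fix f
    have "(\<integral>\<^sup>+y. F (?T (f(?b := y))) \<partial>lborel)
        = ennreal \<bar>1\<bar> * (\<integral>\<^sup>+y. F (?T (f(?b := f ?c + 1 * y))) \<partial>lborel)"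
    proof (rule nn_integral_real_affine)
      have "(\<lambda>y. ?T (f(?b := y))) \<in> borel_measurable borel"
        by (rule borel_measurable_sum) (auto intro!: borel_measurable_scaleR)
      then show "(\<lambda>y. F (?T (f(?b := y)))) \<in> borel_measurable borel"
        by measurable
    qed simp
    then show "(\<integral>\<^sup>+y. F (?T (f(?b := f ?c + 1 * y))) \<partial>lborel) = (\<integral>\<^sup>+y. F (?T (f(?b := y))) \<partial>lborel)"
      by simp
  qed
  also have "\<dots> = (\<integral>\<^sup>+x. F x \<partial>lborel)"
    by (rule split [symmetric]) measurable
  finally show ?thesis .
qed

text \<open>Lebesgue measure is determined by its values on boxes, and swapping two coordinates maps
  a box to a box with the same side lengths in another order.\<close>

lemma distr_lborel_transposition:
  fixes m n :: "'n::finite"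
  defines "h \<equiv> \<lambda>x::real^'n. \<chi> i. x $ Transposition.transpose m n i"
  shows "distr lborel borel h = lborel"
proof (rule lborel_eqI [symmetric])
  have lin: "linear h"
    unfolding h_def by (rule linearI) (simp_all add: vec_eq_iff)
  then have [measurable]: "h \<in> borel_measurable borel"
    by (simp add: borel_measurable_continuous_onI linear_continuous_on linear_conv_bounded_linear)
  have comp: "h x \<bullet> axis i 1 = x \<bullet> axis (Transposition.transpose m n i) 1" for x i
    by (simp add: h_def inner_axis)
  fix l u :: "real^'n"
  assume le: "\<And>b. b \<in> Basis \<Longrightarrow> l \<bullet> b \<le> u \<bullet> b"
  then have le': "h l \<bullet> b \<le> h u \<bullet> b" if "b \<in> Basis" for b
  proof -
    obtain i where b: "b = axis i 1"
      using \<open>b \<in> Basis\<close> by (auto simp: Basis_vec_def)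
    then show ?thesis
      unfolding b comp by (intro le) simp
  qed
  have "h -` box l u = box (h l) (h u)"
  proof safe
    fix x assume "h x \<in> box l u"
    then show "x \<in> box (h l) (h u)"
      by (simp add: mem_box_cart h_def) (metis transpose_involutory)
  next
    fix x assume "x \<in> box (h l) (h u)"
    then show "x \<in> h -` box l u"
      by (simp add: mem_box_cart h_def) (metis transpose_involutory)
  qed
  then have "emeasure (distr lborel borel h) (box l u) = emeasure lborel (box (h l) (h u))"
    by (simp add: emeasure_distr)
  also have "\<dots> = ennreal (\<Prod>b\<in>Basis. (h u - h l) \<bullet> b)"
    using le' by (simp add: emeasure_lborel_box)
  also have "(\<Prod>b\<in>Basis. (h u - h l) \<bullet> b) = (\<Prod>i\<in>UNIV. (u - l) $ Transposition.transpose m n i)"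
    by (simp add: prod_Basis_cart inner_axis h_def)
  also have "\<dots> = (\<Prod>i\<in>UNIV. (u - l) $ i)"
    by (rule prod.reindex_bij_betw) (simp add: bij_swap_iff)
  also have "\<dots> = (\<Prod>b\<in>Basis. (u - l) \<bullet> b)"
    by (simp add: prod_Basis_cart inner_axis)
  finally show "emeasure (distr lborel borel h) (box l u) = ennreal (\<Prod>b\<in>Basis. (u - l) \<bullet> b)" .
qed simp

lemma det_shear:
  fixes m n :: "'n::finite"
  assumes "m \<noteq> n"
  shows "det ((\<chi> i j. of_bool (i = m \<and> j = n \<or> i = j)) :: real^'n^'n) = 1"
proof -
  have *: "((\<chi> i j. of_bool (i = m \<and> j = n \<or> i = j)) :: real^'n^'n)
      = (\<chi> k. if k = m then row m (mat 1) + 1 *s row n (mat 1) else row k (mat 1))"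
    unfolding vec_eq_iff row_def mat_def using assms by simp
  show ?thesis
    unfolding * using det_row_operation [OF assms, of "mat 1 :: real^'n^'n" 1] by simp
qed

lemma shear_mult_vec:
  fixes m n :: "'n::finite" and x :: "real^'n"
  assumes "m \<noteq> n"
  shows "(\<chi> i j. of_bool (i = m \<and> j = n \<or> i = j)) *v x = x + x $ n *\<^sub>R axis m 1"
proof -
  have "(\<Sum>j\<in>UNIV. of_bool (i = m \<and> j = n \<or> i = j) * x $ j) = x $ i + x $ n * axis m 1 $ i" for i
  proof (cases "i = m")
    case True
    have "(\<Sum>j\<in>UNIV. of_bool (i = m \<and> j = n \<or> i = j) * x $ j) =
        (\<Sum>j\<in>UNIV. (if j = i then x $ j else 0) + (if j = n then x $ j else 0))"
      using assms True by (intro sum.cong) auto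
    then show ?thesis
      using True by (simp add: sum.distrib axis_def)
  next
    case False
    have "(\<Sum>j\<in>UNIV. of_bool (i = m \<and> j = n \<or> i = j) * x $ j) =
        (\<Sum>j\<in>UNIV. (if j = i then x $ j else 0))"
      using False by (intro sum.cong) auto
    then show ?thesis
      using False by (simp add: axis_def)
  qed
  then show ?thesis
    by (simp add: matrix_vector_mult_def vec_eq_iff)
qed

text \<open>The library proves the change of variables formula only for well-ordered index types;
  the decomposition into elementary matrices does not need the order.\<close>

lemma nn_integral_lborel_linear:
  fixes A :: "real^'n^'n"
  assumes "det A \<noteq> 0" and "F \<in> borel_measurable borel"
  shows "(\<integral>\<^sup>+x. F x \<partial>lborel) = ennreal \<bar>det A\<bar> * (\<integral>\<^sup>+x. F (A *v x) \<partial>lborel)"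
proof -
  \<comment> \<open>The quantifier over \<open>F\<close> belongs to the induction predicate: for a
    product \<open>A ** B\<close> the hypothesis on \<open>B\<close> is applied to \<open>F\<close>
    composed with \<open>A\<close>. The guard on the determinant makes the case of a zero row
    vacuous.\<close>
  define P where "P A \<longleftrightarrow> (det A \<noteq> 0 \<longrightarrow> (\<forall>F\<in>borel_measurable borel.
      (\<integral>\<^sup>+x. F x \<partial>lborel) = ennreal \<bar>det A\<bar> * (\<integral>\<^sup>+x. F (A *v x) \<partial>lborel)))" for A :: "real^'n^'n"
  have "P A"
  proof (rule induct_matrix_elementary_alt)
    fix A B :: "real^'n^'n"
    assume A: "P A" and B: "P B"
    show "P (A ** B)"
      unfolding P_def
    proof (intro impI ballI)
      fix F :: "real^'n \<Rightarrow> ennreal"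
      assume nz: "det (A ** B) \<noteq> 0" and F [measurable]: "F \<in> borel_measurable borel"
      from nz have nzA: "det A \<noteq> 0" and nzB: "det B \<noteq> 0"
        by (auto simp: det_mul)
      have "(\<integral>\<^sup>+x. F x \<partial>lborel) = ennreal \<bar>det A\<bar> * (\<integral>\<^sup>+x. F (A *v x) \<partial>lborel)"
        using A nzA F unfolding P_def by blast
      also have "(\<integral>\<^sup>+x. F (A *v x) \<partial>lborel) = ennreal \<bar>det B\<bar> * (\<integral>\<^sup>+x. F (A *v (B *v x)) \<partial>lborel)"
      proof -
        have "(\<lambda>x. F (A *v x)) \<in> borel_measurable borel"
          by measurable
        then show ?thesis
          using B nzB unfolding P_def by blast
      qed
      finally show "(\<integral>\<^sup>+x. F x \<partial>lborel)
          = ennreal \<bar>det (A ** B)\<bar> * (\<integral>\<^sup>+x. F ((A ** B) *v x) \<partial>lborel)"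
        by (simp add: det_mul abs_mult ennreal_mult matrix_vector_mul_assoc mult.assoc)
    qed
  next
    fix A :: "real^'n^'n" and i
    assume "row i A = 0"
    then have "det A = 0"
      by (rule det_zero_row)
    then show "P A"
      by (simp add: P_def)
  next
    fix A :: "real^'n^'n"
    assume diag: "\<And>i j. i \<noteq> j \<Longrightarrow> A $ i $ j = 0"
    then have det: "det A = (\<Prod>i\<in>UNIV. A $ i $ i)"
      by (rule det_diagonal)
    define c where "c b = (A *v b) \<bullet> b" for b
    have c: "c (axis i 1) = A $ i $ i" for i
      by (simp add: c_def inner_axis matrix_vector_mult_basis column_def)
    have eq: "0 + (\<Sum>j\<in>Basis. (c j * (x \<bullet> j)) *\<^sub>R j) = A *v x" for x
    proof (rule euclidean_eqI)
      fix b :: "real^'n"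
      assume "b \<in> Basis"
      then obtain i where b: "b = axis i 1"
        by (auto simp: Basis_vec_def)
      have "(0 + (\<Sum>j\<in>Basis. (c j * (x \<bullet> j)) *\<^sub>R j)) \<bullet> b = c b * (x \<bullet> b)"
        using \<open>b \<in> Basis\<close> by simp
      also have "\<dots> = A $ i $ i * x $ i"
        by (simp add: b c inner_axis)
      also have "\<dots> = (\<Sum>j\<in>UNIV. A $ i $ j * x $ j)"
        by (subst sum.remove [of _ i]) (auto simp: diag intro!: sum.neutral)
      also have "\<dots> = (A *v x) \<bullet> b"
        by (simp add: b inner_axis matrix_vector_mult_def)
      finally show "(0 + (\<Sum>j\<in>Basis. (c j * (x \<bullet> j)) *\<^sub>R j)) \<bullet> b = (A *v x) \<bullet> b" .
    qed
    show "P A"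
      unfolding P_def
    proof (intro impI ballI)
      fix F :: "real^'n \<Rightarrow> ennreal"
      assume nz: "det A \<noteq> 0" and F [measurable]: "F \<in> borel_measurable borel"
      have "c j \<noteq> 0" if "j \<in> Basis" for j
        using that nz by (auto simp: Basis_vec_def c det)
      moreover have "(\<Prod>j\<in>Basis. \<bar>c j\<bar>) = \<bar>det A\<bar>"
        by (simp add: prod_Basis_cart c det abs_prod)
      ultimately have *: "lborel = density (distr lborel borel ((*v) A)) (\<lambda>_. ennreal \<bar>det A\<bar>)"
        using lborel_affine_euclidean [of c 0, unfolded eq] by metis
      show "(\<integral>\<^sup>+x. F x \<partial>lborel) = ennreal \<bar>det A\<bar> * (\<integral>\<^sup>+x. F (A *v x) \<partial>lborel)"
        by (subst *) (simp add: nn_integral_density nn_integral_distr nn_integral_cmult)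
    qed
  next
    fix m n :: 'n
    assume "m \<noteq> n"
    define S :: "real^'n^'n" where "S = (\<chi> i j. mat 1 $ i $ Transposition.transpose m n j)"
    have S: "S *v x = (\<chi> i. x $ Transposition.transpose m n i)" for x
    proof -
      have "(\<Sum>j\<in>UNIV. (if i = Transposition.transpose m n j then 1 else 0) * x $ j)
          = (\<Sum>j\<in>UNIV. if j = Transposition.transpose m n i then x $ j else 0)" for i
        by (rule sum.cong) auto
      then show ?thesis
        by (simp add: S_def mat_def matrix_vector_mult_def)
    qed
    have det: "\<bar>det S\<bar> = 1"
      using \<open>m \<noteq> n\<close> by (simp add: S_def det_permute_columns permutes_swap_id sign_swap_id)
    have "(\<integral>\<^sup>+x. F x \<partial>lborel) = (\<integral>\<^sup>+x. F (S *v x) \<partial>lborel)"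
      if [measurable]: "F \<in> borel_measurable borel" for F
    proof -
      have "lborel = distr lborel borel ((*v) S)"
        using distr_lborel_transposition [of m n] by (simp add: S [abs_def])
      then have "(\<integral>\<^sup>+x. F x \<partial>lborel) = (\<integral>\<^sup>+x. F x \<partial>distr lborel borel ((*v) S))"
        by simp
      then show ?thesis
        by (simp add: nn_integral_distr)
    qed
    then show "P (\<chi> i j. mat 1 $ i $ Transposition.transpose m n j)"
      unfolding S_def [symmetric] P_def det ennreal_1 mult_1 by blast
  next
    fix m n :: 'n
    assume "m \<noteq> n"
    show "P (\<chi> i j. of_bool (i = m \<and> j = n \<or> i = j))"
      unfolding P_def
    proof (intro impI ballI)
      fix F :: "real^'n \<Rightarrow> ennreal"
      assume F: "F \<in> borel_measurable borel"
      show "(\<integral>\<^sup>+x. F x \<partial>lborel)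
          = ennreal \<bar>det ((\<chi> i j. of_bool (i = m \<and> j = n \<or> i = j)) :: real^'n^'n)\<bar>
            * (\<integral>\<^sup>+x. F ((\<chi> i j. of_bool (i = m \<and> j = n \<or> i = j)) *v x) \<partial>lborel)"
        unfolding det_shear [OF \<open>m \<noteq> n\<close>] shear_mult_vec [OF \<open>m \<noteq> n\<close>]
          nn_integral_lborel_shear [OF F \<open>m \<noteq> n\<close>] abs_one ennreal_1 mult_1 by (rule refl)
    qed
  qed
  then show ?thesis
    using assms unfolding P_def by blast
qed

text \<open>As an equality of measures the substitution rule also serves Bochner integrals of
  vector-valued functions, through the rules for \<open>density\<close> and
  \<open>distr\<close>.\<close>

lemma lborel_linear:
  fixes A :: "real^'n^'n"
  assumes "det A \<noteq> 0"
  shows "lborel = density (distr lborel borel ((*v) A)) (\<lambda>_. ennreal \<bar>det A\<bar>)"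
proof (rule measure_eqI)
  fix S :: "(real^'n) set"
  assume "S \<in> sets lborel"
  then have [measurable]: "S \<in> sets borel"
    by simp
  have "emeasure lborel S = (\<integral>\<^sup>+x. indicator S x \<partial>lborel)"
    by simp
  also have "\<dots> = ennreal \<bar>det A\<bar> * (\<integral>\<^sup>+x. indicator S (A *v x) \<partial>lborel)"
    by (rule nn_integral_lborel_linear [OF assms]) measurable
  also have "\<dots> = (\<integral>\<^sup>+x. ennreal \<bar>det A\<bar> * indicator S x \<partial>distr lborel borel ((*v) A))"
    by (simp add: nn_integral_distr nn_integral_cmult del: nn_integral_indicator)
  also have "\<dots> = emeasure (density (distr lborel borel ((*v) A)) (\<lambda>_. ennreal \<bar>det A\<bar>)) S"
    by (simp add: emeasure_density)
  finally show "emeasure lborel S = \<dots>" .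
qed simp

text \<open>Integrability passes from the standardized variable back to \<open>f\<close>, so
  existence and value of a Gaussian integral are obtained together.\<close>

lemma has_bochner_integral_lborel_affine:
  fixes A :: "real^'n^'n" and f :: "real^'n \<Rightarrow> 'b::{banach, second_countable_topology}"
  assumes "det A \<noteq> 0" and [measurable]: "f \<in> borel_measurable borel"
    and int: "has_bochner_integral lborel (\<lambda>x. \<bar>det A\<bar> *\<^sub>R f (b + A *v x)) I"
  shows "has_bochner_integral lborel f I"
proof -
  have "has_bochner_integral lborel (\<lambda>x. f (b + x)) I"
    by (subst lborel_linear [OF assms(1)])
       (intro has_bochner_integral_density has_bochner_integral_distr; simp add: int)
  then have "has_bochner_integral (distr lborel borel ((+) b)) f I"
    by (intro has_bochner_integral_distr) simp_all
  then show ?thesis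
    by (simp add: lborel_distr_plus)
qed

subsection \<open>Matrix calculus\<close>

lemma bounded_bilinear_matrix_mult:
  "bounded_bilinear ((**) :: real^'n^'m \<Rightarrow> real^'k^'n \<Rightarrow> real^'k^'m)"
  unfolding bilinear_conv_bounded_bilinear [symmetric] bilinear_def
  by (auto intro!: linearI simp: matrix_matrix_mult_def vec_eq_iff sum.distrib sum_distrib_left algebra_simps)

lemmas matrix_mult_distribs =
  bounded_bilinear.add_left [OF bounded_bilinear_matrix_mult]
  bounded_bilinear.add_right [OF bounded_bilinear_matrix_mult]
  bounded_bilinear.diff_left [OF bounded_bilinear_matrix_mult]
  bounded_bilinear.diff_right [OF bounded_bilinear_matrix_mult]
  bounded_bilinear.scaleR_left [OF bounded_bilinear_matrix_mult]
  bounded_bilinear.scaleR_right [OF bounded_bilinear_matrix_mult]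

lemma trace_diff: "trace (A - B :: real^'n^'n) = trace A - trace B"
  by (simp add: trace_def sum_subtractf)

lemma trace_scaleR: "trace (c *\<^sub>R A :: real^'n^'n) = c * trace A"
  by (simp add: trace_def sum_distrib_left)

lemma bounded_linear_trace: "bounded_linear (trace :: real^'n^'n \<Rightarrow> real)"
  unfolding linear_conv_bounded_linear [symmetric]
  by (rule linearI) (simp_all add: trace_add trace_scaleR)

lemma transpose_diff: "transpose (A - B :: real^'n^'m) = transpose A - transpose B"
  by (simp add: transpose_def vec_eq_iff)

lemma det_scaleR: "det (c *\<^sub>R A :: real^'n^'n) = c ^ CARD('n) * det A"
proof -
  have "c *\<^sub>R A = matrix ((*\<^sub>R) c) ** A"
    by (simp add: matrix_scaleR matrix_matrix_mult_def mat_def vec_eq_iff if_distrib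
        [of "\<lambda>x. x * y" for y] cong: if_cong)
  then show ?thesis
    by (simp add: det_mul)
qed

lemma inner_matrix_vector_mult: "x \<bullet> (A *v y) = (transpose A *v x) \<bullet> (y :: real^'n)"
  by (simp add: dot_lmul_matrix)

lemma matrix_inv_mult:
  fixes A :: "real^'n^'n"
  assumes "invertible A"
  shows "A ** matrix_inv A = mat 1" "matrix_inv A ** A = mat 1"
proof -
  from assms have "A ** matrix_inv A = mat 1 \<and> matrix_inv A ** A = mat 1"
    unfolding invertible_def matrix_inv_def by (rule someI_ex)
  then show "A ** matrix_inv A = mat 1" "matrix_inv A ** A = mat 1"
    by simp_all
qed

lemma matrix_inv_eqI:
  fixes A B :: "real^'n^'n"
  assumes "A ** B = mat 1"
  shows "matrix_inv A = B"
proof -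
  have "invertible A"
    using assms invertible_right_inverse by blast
  then have "matrix_inv A ** (A ** B) = B"
    by (simp add: matrix_mul_assoc matrix_inv_mult)
  then show ?thesis
    by (simp add: assms)
qed

text \<open>Differentiate the Leibniz sum term by term. A permutation other than the identity moves
  at least two indices, so when one factor has been differentiated an off-diagonal zero of the
  identity matrix is still left; only the identity permutation contributes.\<close>

lemma det_has_derivative_mat1: "(det has_derivative trace) (at (mat 1 :: real^'n^'n))"
proof -
  let ?U = "UNIV :: 'n set"
  let ?D = "\<lambda>p (E::real^'n^'n). of_int (sign p) * (\<Sum>i\<in>?U. E $ i $ p i * (\<Prod>j\<in>?U - {i}. mat 1 $ j $ p j)) :: real"
  have "((\<lambda>A. \<Sum>p | p permutes ?U. of_int (sign p) * (\<Prod>i\<in>?U. A $ i $ p i))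
      has_derivative (\<lambda>E. \<Sum>p | p permutes ?U. ?D p E)) (at (mat 1 :: real^'n^'n))"
    by (intro has_derivative_sum has_derivative_mult_right has_derivative_prod
        bounded_linear.has_derivative [OF bounded_linear_vec_nth] has_derivative_ident)
  moreover have "(\<Sum>p | p permutes ?U. ?D p E) = trace E" for E
  proof -
    have 0: "?D p E = 0" if p: "p permutes ?U" "p \<noteq> id" for p
    proof -
      have "(\<Prod>j\<in>?U - {i}. mat 1 $ j $ p j) = (0::real)" for i
      proof -
        have "\<exists>j. j \<noteq> i \<and> p j \<noteq> j"
        proof (rule ccontr)
          assume "\<not> (\<exists>j. j \<noteq> i \<and> p j \<noteq> j)"
          then have *: "p j = j" if "j \<noteq> i" for j
            using that by blast
          moreover have "p i = i"
            using * permutes_inj [OF p(1)] by (metis injD)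
          ultimately have "p = id"
            by (metis eq_id_iff)
          with p show False
            by simp
        qed
        then obtain j where "j \<noteq> i" "p j \<noteq> j"
          by blast
        then show ?thesis
          by (intro prod_zero bexI [of _ j]) (auto simp: mat_def)
      qed
      then show ?thesis
        by (simp only: mult_zero_right sum.neutral_const)
    qed
    have "(\<Sum>p | p permutes ?U. ?D p E) = (\<Sum>p\<in>{id}. ?D p E)"
      using 0 by (intro sum.mono_neutral_right finite_permutations) (auto simp: permutes_id)
    also have "\<dots> = trace E"
      by (simp add: sign_id mat_def trace_def)
    finally show ?thesis .
  qed
  ultimately show ?thesis
    unfolding det_def [abs_def] by simp
qed

text \<open>Jacobi's formula, transported from the identity by \<open>det (A + E) = det A * det (mat 1 + A\<inverse> E)\<close>.\<close>

lemma det_has_derivative: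
  fixes A :: "real^'n^'n"
  assumes "invertible A"
  shows "(det has_derivative (\<lambda>E. det A * trace (matrix_inv A ** E))) (at A)"
proof -
  let ?h = "\<lambda>E. matrix_inv A ** E"
  have "bounded_linear ?h"
    by (rule bounded_bilinear.bounded_linear_right [OF bounded_bilinear_matrix_mult])
  then have h: "(?h has_derivative ?h) (at A)"
    by (rule bounded_linear_imp_has_derivative)
  have "(det has_derivative trace) (at (?h A))"
    using det_has_derivative_mat1 by (simp add: matrix_inv_mult assms)
  then have "((\<lambda>E. det A * det (?h E)) has_derivative (\<lambda>E. det A * trace (?h E))) (at A)"
    by (intro has_derivative_mult_right has_derivative_compose [OF h])
  moreover have "det A * det (?h E) = det E" for E
    by (metis assms det_mul matrix_inv_mult(1) matrix_mul_assoc matrix_mul_lid)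
  ultimately show ?thesis
    by simp
qed

lemma has_real_derivative_ln_det:
  fixes A :: "real \<Rightarrow> real^'n^'n"
  assumes A: "(A has_vector_derivative A') (at t)" and pos: "0 < det (A t)"
  shows "((\<lambda>s. ln (det (A s))) has_real_derivative trace (matrix_inv (A t) ** A')) (at t)"
proof -
  have inv: "invertible (A t)"
    using pos by (simp add: invertible_det_nz)
  have "((\<lambda>s. det (A s)) has_derivative (\<lambda>h. det (A t) * trace (matrix_inv (A t) ** (h *\<^sub>R A')))) (at t)"
    using A det_has_derivative [OF inv] unfolding has_vector_derivative_def by (rule has_derivative_compose)
  then have "((\<lambda>s. det (A s)) has_real_derivative det (A t) * trace (matrix_inv (A t) ** A')) (at t)"
    by (simp add: has_field_derivative_def matrix_mult_distribs trace_scaleR mult_ac mult_commute_abs)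
  then show ?thesis
    using pos by (auto intro!: derivative_eq_intros)
qed

text \<open>A first resolvent identity determines the derivative; continuity need not be assumed,
  since the identity bounds \<open>F s\<close> near \<open>t\<close>.\<close>

lemma resolvent_has_vector_derivative:
  fixes F :: "real \<Rightarrow> real^'n^'n"
  assumes res: "\<And>s t. 0 < s \<Longrightarrow> 0 < t \<Longrightarrow> F s - F t = (1 / t - 1 / s) *\<^sub>R (F s ** G ** F t)"
    and t: "0 < t"
  shows "(F has_vector_derivative (1 / t\<^sup>2) *\<^sub>R (F t ** G ** F t)) (at t)"
proof -
  have ev: "eventually (\<lambda>s. 0 < s) (at t)"
    using t by (intro order_tendstoD(1) [OF tendsto_ident_at])
  obtain K where K: "norm (F s ** (G ** F t)) \<le> norm (F s) * K" "0 < K" for s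
    using bounded_linear.pos_bounded [OF bounded_bilinear.bounded_linear_left [OF bounded_bilinear_matrix_mult]]
    by metis
  have lim: "((\<lambda>s. 1 / t - 1 / s) \<longlongrightarrow> 0) (at t)"
    using t by (auto intro!: tendsto_eq_intros)
  then have "((\<lambda>s. \<bar>1 / t - 1 / s\<bar> * K) \<longlongrightarrow> 0) (at t)"
    by (intro tendsto_mult_left_zero tendsto_rabs_zero)
  then have ev2: "eventually (\<lambda>s. \<bar>1 / t - 1 / s\<bar> * K < 1 / 2) (at t)"
    by (rule order_tendstoD) simp
  \<comment> \<open>Absorption: right multiplication by the fixed matrix \<open>G ** F t\<close>
    costs a factor \<open>K\<close>, so close to \<open>t\<close> the resolvent identity bounds
    \<open>norm (F s - F t)\<close> by half of \<open>norm (F s)\<close>, and this half moves to the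
    left-hand side.\<close>
  have bd: "eventually (\<lambda>s. norm (F s) \<le> 2 * norm (F t)) (at t)"
    using ev ev2
  proof eventually_elim
    case (elim s)
    have "norm (F s) \<le> norm (F t) + norm (F s - F t)"
      by norm
    also have "norm (F s - F t) \<le> \<bar>1 / t - 1 / s\<bar> * (norm (F s) * K)"
      using K(1) [of s] by (simp add: res [OF elim(1) t] matrix_mul_assoc [symmetric] mult_left_mono)
    also have "\<dots> = (\<bar>1 / t - 1 / s\<bar> * K) * norm (F s)"
      by simp
    also have "\<dots> \<le> 1 / 2 * norm (F s)"
      using elim by (intro mult_right_mono) auto
    finally show ?case
      by simp
  qed
  have cont: "(F \<longlongrightarrow> F t) (at t)"
  proof -
    have "((\<lambda>s. F s - F t) \<longlongrightarrow> 0) (at t)"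
    proof (rule Lim_null_comparison)
      show "eventually (\<lambda>s. norm (F s - F t) \<le> \<bar>1 / t - 1 / s\<bar> * (2 * norm (F t) * K)) (at t)"
        using ev bd
      proof eventually_elim
        case (elim s)
        have "norm (F s ** (G ** F t)) \<le> 2 * norm (F t) * K"
          using K(1) [of s] K(2) elim(2) by (meson mult_right_mono less_imp_le order_trans)
        then show ?case
          by (simp add: res [OF elim(1) t] matrix_mul_assoc [symmetric] mult_left_mono)
      qed
      show "((\<lambda>s. \<bar>1 / t - 1 / s\<bar> * (2 * norm (F t) * K)) \<longlongrightarrow> 0) (at t)"
        using lim by (intro tendsto_mult_left_zero tendsto_rabs_zero)
    qed
    then show ?thesis
      by (rule Lim_null [THEN iffD2])
  qed
  \<comment> \<open>Since 1/t - 1/s = (s - t)/(s t), this is the difference quotient of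
    \<open>F\<close> for \<open>s\<close> different from \<open>t\<close>, written without the
    singular denominator.\<close>
  let ?q = "\<lambda>s. (1 / (s * t)) *\<^sub>R (F s ** (G ** F t))"
  have q: "(?q \<longlongrightarrow> (1 / t\<^sup>2) *\<^sub>R (F t ** G ** F t)) (at t)"
    using t by (auto intro!: tendsto_eq_intros cont
        bounded_bilinear.tendsto [OF bounded_bilinear_matrix_mult] simp: power2_eq_square matrix_mul_assoc)
  have "((\<lambda>s. norm (F s - F t - (s - t) *\<^sub>R ((1 / t\<^sup>2) *\<^sub>R (F t ** G ** F t))) / norm (s - t)) \<longlongrightarrow> 0) (at t)"
  proof (rule Lim_transform_eventually)
    show "((\<lambda>s. norm (?q s - (1 / t\<^sup>2) *\<^sub>R (F t ** G ** F t))) \<longlongrightarrow> 0) (at t)"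
      using q by (simp add: Lim_null [symmetric] tendsto_norm_zero_iff)
    show "eventually (\<lambda>s. norm (?q s - (1 / t\<^sup>2) *\<^sub>R (F t ** G ** F t))
        = norm (F s - F t - (s - t) *\<^sub>R ((1 / t\<^sup>2) *\<^sub>R (F t ** G ** F t))) / norm (s - t)) (at t)"
      using ev eventually_neq_at_within [of t t UNIV]
    proof eventually_elim
      case (elim s)
      have "F s - F t = (s - t) *\<^sub>R ?q s"
        using t elim by (simp add: res [OF elim(1) t] matrix_mul_assoc field_simps)
      then have "F s - F t - (s - t) *\<^sub>R ((1 / t\<^sup>2) *\<^sub>R (F t ** G ** F t))
          = (s - t) *\<^sub>R (?q s - (1 / t\<^sup>2) *\<^sub>R (F t ** G ** F t))"
        by (simp only: scaleR_diff_right)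
      then show ?case
        using elim by simp
    qed
  qed
  then show ?thesis
    unfolding has_vector_derivative_def has_derivative_iff_norm
    by (intro conjI bounded_linear_scaleR_left)
qed

subsection \<open>Gaussian integrals\<close>

lemma has_bochner_integral_lborel_prod:
  fixes f :: "'n::finite \<Rightarrow> real \<Rightarrow> real"
  assumes f: "\<And>i. has_bochner_integral lborel (f i) (I i)"
  shows "has_bochner_integral lborel (\<lambda>x::real^'n. \<Prod>i\<in>UNIV. f i (x $ i)) (\<Prod>i\<in>UNIV. I i)"
proof -
  interpret product_sigma_finite "\<lambda>_::real^'n. lborel::real measure"
    by standard
  \<comment> \<open>The product measure underlying \<open>lborel\<close> is indexed by basis
    vectors; \<open>k\<close> recovers the coordinate from its basis vector.\<close>
  define k where "k = inv (\<lambda>i::'n. axis i (1::real))"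
  have "inj (\<lambda>i::'n. axis i (1::real))"
    by (auto simp: inj_on_def axis_eq_axis)
  then have k: "k (axis i 1) = i" for i
    unfolding k_def by (rule inv_f_f)
  have [measurable]: "f i \<in> borel_measurable borel" for i
    using borel_measurable_has_bochner_integral [OF f [of i]] by simp
  have int: "integrable lborel (f i)" "integral\<^sup>L lborel (f i) = I i" for i
    using f [of i] by (simp_all add: has_bochner_integral_iff)
  have "integrable (\<Pi>\<^sub>M b\<in>(Basis::(real^'n) set). lborel) (\<lambda>g. \<Prod>b\<in>Basis. f (k b) (g b))"
    by (intro product_integrable_prod int) simp
  moreover have "integral\<^sup>L (\<Pi>\<^sub>M b\<in>(Basis::(real^'n) set). lborel) (\<lambda>g. \<Prod>b\<in>Basis. f (k b) (g b))
      = (\<Prod>b\<in>(Basis::(real^'n) set). I (k b))"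
    by (subst product_integral_prod) (simp_all add: int)
  ultimately have "has_bochner_integral (\<Pi>\<^sub>M b\<in>(Basis::(real^'n) set). lborel)
      (\<lambda>g. \<Prod>b\<in>Basis. f (k b) (g b)) (\<Prod>i\<in>UNIV. I i)"
    by (simp add: has_bochner_integral_iff prod_Basis_cart k)
  moreover have "(\<Prod>b\<in>Basis. f (k b) (g b)) = (\<Prod>i\<in>UNIV. f i ((\<Sum>b\<in>Basis. g b *\<^sub>R b :: real^'n) $ i))" for g
  proof -
    have "(\<Sum>b\<in>Basis. g b *\<^sub>R b :: real^'n) $ i = (\<Sum>b\<in>Basis. g b *\<^sub>R b) \<bullet> axis i 1" for i
      by (simp add: inner_axis)
    also have "\<dots> i = g (axis i 1)" for i
      by (subst inner_sum_left_Basis) auto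
    finally show ?thesis
      by (simp add: prod_Basis_cart k)
  qed
  ultimately show ?thesis
    by (subst lborel_eq) (intro has_bochner_integral_distr, auto)
qed

definition std_gaussian :: "real^'n \<Rightarrow> real" where
  "std_gaussian z = (\<Prod>i\<in>UNIV. std_normal_density (z $ i))"

lemma std_gaussian_altdef:
  "std_gaussian (z::real^'n) = exp (- (z \<bullet> z) / 2) / sqrt ((2 * pi) ^ CARD('n))"
  unfolding real_sqrt_power
  by (simp add: std_gaussian_def std_normal_density_def prod_dividef exp_sum [symmetric] inner_vec_def
      sum_negf sum_divide_distrib power2_eq_square)

text \<open>All three are instances of one monomial formula. With exponents below 3 the moment
  factors over the coordinates, and a one-dimensional factor is 1 for the exponents 0 and 2 and 0
  for the exponent 1. A product of two different coordinates has exponent 1 in each of them; a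
  square has exponent 2.\<close>

lemma std_gaussian_moments:
  "has_bochner_integral lborel (std_gaussian :: real^'n \<Rightarrow> real) 1"
  "has_bochner_integral lborel (\<lambda>z::real^'n. std_gaussian z * z $ i) 0"
  "has_bochner_integral lborel (\<lambda>z::real^'n. std_gaussian z * (z $ i * z $ j)) (of_bool (i = j))"
proof -
  have m: "has_bochner_integral lborel (\<lambda>x. std_normal_density x * x ^ k) (of_bool (k \<noteq> 1))" if "k < 3" for k
  proof -
    consider "k = 0" | "k = 1" | "k = 2"
      using \<open>k < 3\<close> by linarith
    then show ?thesis
      using std_normal_moment_even [of 0] std_normal_moment_even [of 1] std_normal_moment_odd [of 0]
      by cases (simp_all add: fact_2)
  qed
  have prod: "has_bochner_integral lborel (\<lambda>z::real^'n. std_gaussian z * (\<Prod>l\<in>UNIV. z $ l ^ k l))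
      (\<Prod>l\<in>UNIV. of_bool (k l \<noteq> 1))" if "\<And>l. k l < 3" for k
    using has_bochner_integral_lborel_prod [of "\<lambda>l x. std_normal_density x * x ^ k l", OF m, OF that]
    by (simp add: std_gaussian_def prod.distrib)
  show "has_bochner_integral lborel (std_gaussian :: real^'n \<Rightarrow> real) 1"
    using prod [of "\<lambda>l. 0"] by simp
  have pow: "(\<Prod>l\<in>UNIV. x $ l ^ of_bool (l = i)) = x $ i" for x :: "real^'n" and i
    by (subst prod.remove [of _ i]) auto
  have lt: "of_bool P < (3::nat)" "of_bool P + of_bool Q < (3::nat)" for P Q
    by (simp_all add: of_bool_def)
  have "(\<Prod>l\<in>UNIV. of_bool ((of_bool (l = i) :: nat) \<noteq> 1)) = (0 :: real)"
    by (intro prod_zero bexI [of _ i]) simp_all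
  then show "has_bochner_integral lborel (\<lambda>z::real^'n. std_gaussian z * z $ i) 0"
    using prod [of "\<lambda>l. of_bool (l = i)", OF lt(1)] by (simp only: pow)
  have "(\<Prod>l\<in>UNIV. of_bool ((of_bool (l = i) + of_bool (l = j) :: nat) \<noteq> 1)) = (of_bool (i = j) :: real)"
  proof (cases "i = j")
    case False
    then have "(\<Prod>l\<in>UNIV. of_bool ((of_bool (l = i) + of_bool (l = j) :: nat) \<noteq> 1)) = (0 :: real)"
      by (intro prod_zero bexI [of _ i]) simp_all
    with False show ?thesis
      by simp
  qed (auto intro!: prod.neutral)
  then show "has_bochner_integral lborel (\<lambda>z::real^'n. std_gaussian z * (z $ i * z $ j)) (of_bool (i = j))"
    using prod [of "\<lambda>l. of_bool (l = i) + of_bool (l = j)", OF lt(2)]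
    by (simp only: pow power_add prod.distrib)
qed

lemma std_gaussian_quadratic:
  "has_bochner_integral lborel (\<lambda>z::real^'n. std_gaussian z * (a + c \<bullet> z + z \<bullet> (M *v z))) (a + trace M)"
proof -
  have "has_bochner_integral lborel
      (\<lambda>z::real^'n. a * std_gaussian z + (\<Sum>i\<in>UNIV. c $ i * (std_gaussian z * z $ i))
        + (\<Sum>i\<in>UNIV. \<Sum>j\<in>UNIV. M $ i $ j * (std_gaussian z * (z $ i * z $ j))))
      (a * 1 + (\<Sum>i\<in>UNIV. c $ i * 0) + (\<Sum>i\<in>UNIV. \<Sum>j\<in>UNIV. M $ i $ j * of_bool (i = j)))"
    by (intro has_bochner_integral_add has_bochner_integral_sum has_bochner_integral_mult_right std_gaussian_moments)
  moreover have "(\<Sum>i\<in>UNIV. \<Sum>j\<in>UNIV. M $ i $ j * of_bool (i = j)) = trace M"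
    by (simp add: trace_def of_bool_def if_distrib cong: if_cong)
  moreover have "a * std_gaussian z + (\<Sum>i\<in>UNIV. c $ i * (std_gaussian z * z $ i))
      + (\<Sum>i\<in>UNIV. \<Sum>j\<in>UNIV. M $ i $ j * (std_gaussian z * (z $ i * z $ j)))
      = std_gaussian z * (a + c \<bullet> z + z \<bullet> (M *v z))" for z
    by (simp add: inner_vec_def matrix_vector_mult_def algebra_simps sum_distrib_left)
  ultimately show ?thesis
    by simp
qed

lemma borel_measurable_gaussian_density [measurable]:
  "gaussian_density \<mu> S \<in> borel_measurable borel"
  unfolding gaussian_density_def [abs_def] by measurable

lemma matrix_inv_factor:
  fixes L :: "real^'n^'n"
  assumes "invertible L"
  shows "matrix_inv (L ** transpose L) = transpose (matrix_inv L) ** matrix_inv L"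
proof (rule matrix_inv_eqI)
  let ?K = "matrix_inv L"
  have "L ** transpose L ** (transpose ?K ** ?K) = L ** transpose (?K ** L) ** ?K"
    by (simp add: matrix_transpose_mul matrix_mul_assoc)
  then show "L ** transpose L ** (transpose ?K ** ?K) = mat 1"
    by (simp add: matrix_inv_mult assms)
qed

text \<open>Whitening: the quadratic form becomes \<open>z \<bullet> z\<close>, and the Jacobian
  cancels the square root of the determinant of the covariance, which is
  \<open>\<bar>det L\<bar>\<close>. For this reason covariances below are given as
  \<open>L ** transpose L\<close>, with no further condition on the shape of the invertible
  \<open>L\<close>.\<close>

lemma gaussian_density_affine:
  fixes L :: "real^'n^'n"
  assumes "invertible L"
  shows "\<bar>det L\<bar> * gaussian_density \<mu> (L ** transpose L) (\<mu> + L *v z) = std_gaussian z"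
proof -
  let ?K = "matrix_inv L"
  have KL: "?K *v (L *v z) = z"
    by (simp add: matrix_vector_mul_assoc matrix_inv_mult assms)
  have "(L *v z) \<bullet> (matrix_inv (L ** transpose L) *v (L *v z)) = (L *v z) \<bullet> (transpose ?K *v (?K *v (L *v z)))"
    by (simp only: matrix_inv_factor [OF assms] matrix_vector_mul_assoc matrix_mul_assoc)
  also have "\<dots> = z \<bullet> z"
    by (simp only: inner_matrix_vector_mult transpose_transpose KL)
  finally have *: "(L *v z) \<bullet> (matrix_inv (L ** transpose L) *v (L *v z)) = z \<bullet> z" .
  have "det L \<noteq> 0"
    using assms by (simp add: invertible_det_nz)
  then show ?thesis
    by (simp add: gaussian_density_def std_gaussian_altdef * det_mul real_sqrt_mult)
qed

lemma gaussian_density_nonneg: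
  fixes L :: "real^'n^'n"
  shows "0 \<le> gaussian_density \<mu> (L ** transpose L) y"
  by (simp add: gaussian_density_def det_mul)

lemma has_bochner_integral_gaussian_density:
  fixes L :: "real^'n^'n"
  assumes "invertible L"
  shows "has_bochner_integral lborel (gaussian_density \<mu> (L ** transpose L)) 1"
proof (rule has_bochner_integral_lborel_affine)
  show "det L \<noteq> 0"
    using assms by (simp add: invertible_det_nz)
  show "has_bochner_integral lborel
      (\<lambda>z. \<bar>det L\<bar> *\<^sub>R gaussian_density \<mu> (L ** transpose L) (\<mu> + L *v z)) 1"
    using std_gaussian_moments(1) by (simp add: gaussian_density_affine assms)
qed measurable

lemma gaussian_quadratic_expectation:
  fixes L M :: "real^'n^'n"
  assumes "invertible L"
  shows "has_bochner_integral (density lborel (\<lambda>y. ennreal (gaussian_density \<mu> (L ** transpose L) y)))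
     (\<lambda>y. y \<bullet> (M *v y)) (\<mu> \<bullet> (M *v \<mu>) + trace (M ** (L ** transpose L)))"
proof (rule has_bochner_integral_density)
  \<comment> \<open>The coefficient of the linear term in \<open>z\<close>, whose expectation is
    zero. Its two summands differ in form because \<open>M\<close> need not be symmetric.\<close>
  let ?c = "transpose L *v (M *v \<mu>) + transpose (M ** L) *v \<mu>"
  have expand: "(\<mu> + L *v z) \<bullet> (M *v (\<mu> + L *v z))
      = \<mu> \<bullet> (M *v \<mu>) + ?c \<bullet> z + z \<bullet> ((transpose L ** M ** L) *v z)" for z
  proof -
    have "z \<bullet> ((transpose L ** M ** L) *v z) = z \<bullet> (transpose L *v (M *v (L *v z)))"
      by (simp only: matrix_vector_mul_assoc matrix_mul_assoc)
    also have "\<dots> = (L *v z) \<bullet> (M *v (L *v z))"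
      by (simp only: inner_matrix_vector_mult transpose_transpose)
    finally have 1: "z \<bullet> ((transpose L ** M ** L) *v z) = (L *v z) \<bullet> (M *v (L *v z))" .
    have "?c \<bullet> z = (M *v \<mu>) \<bullet> (L *v z) + \<mu> \<bullet> (M *v (L *v z))"
      using inner_matrix_vector_mult [of "M *v \<mu>" L z] inner_matrix_vector_mult [of \<mu> "M ** L" z]
      by (simp only: inner_add_left matrix_vector_mul_assoc)
    with 1 show ?thesis
      by (simp add: matrix_vector_right_distrib inner_add_left inner_add_right inner_commute)
  qed
  have tr: "trace (transpose L ** M ** L) = trace (M ** (L ** transpose L))"
    by (metis matrix_mul_assoc trace_mul_sym)
  show "has_bochner_integral lborel (\<lambda>y. gaussian_density \<mu> (L ** transpose L) y *\<^sub>R (y \<bullet> (M *v y)))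
      (\<mu> \<bullet> (M *v \<mu>) + trace (M ** (L ** transpose L)))"
  proof (rule has_bochner_integral_lborel_affine)
    show "det L \<noteq> 0"
      using assms by (simp add: invertible_det_nz)
    show "has_bochner_integral lborel
        (\<lambda>z. \<bar>det L\<bar> *\<^sub>R (gaussian_density \<mu> (L ** transpose L) (\<mu> + L *v z)
            *\<^sub>R ((\<mu> + L *v z) \<bullet> (M *v (\<mu> + L *v z)))))
        (\<mu> \<bullet> (M *v \<mu>) + trace (M ** (L ** transpose L)))"
      using std_gaussian_quadratic [of "\<mu> \<bullet> (M *v \<mu>)" ?c "transpose L ** M ** L"]
      unfolding expand tr real_scaleR_def mult.assoc [symmetric] gaussian_density_affine [OF assms] .
  qed measurable
qed (simp_all add: gaussian_density_nonneg)

text \<open>Take an orthonormal basis of the range of \<open>Y\<close> and let the columns of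
  \<open>A\<close> be preimages of its elements. Then \<open>Y ** A\<close> has orthonormal columns,
  so \<open>A ** transpose A\<close> inverts the Gram matrix. This provides the covariance factor
  for the Gaussian in the coefficient vector when that vector is integrated out.\<close>

lemma inverse_gram_factor:
  fixes Y :: "real^'p^'n"
  assumes "inj ((*v) Y)"
  obtains A :: "real^'p^'p" where "invertible A"
    "transpose Y ** Y ** (A ** transpose A) = mat 1"
proof -
  have lin: "linear ((*v) Y)"
    by simp
  let ?S = "range ((*v) Y)"
  have "subspace ?S"
    by (simp add: linear_subspace_image lin)
  then obtain B where B: "B \<subseteq> ?S" "pairwise orthogonal B" "\<And>x. x \<in> B \<Longrightarrow> norm x = 1"
      "independent B" "card B = dim ?S" "span B = ?S"
    using orthonormal_basis_subspace by blast
  have "dim ?S = CARD('p)"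
    using assms by (simp add: dim_image_eq lin)
  then have "card B = CARD('p)"
    using B by simp
  moreover have "finite B"
    using B(4) by (rule independent_imp_finite)
  ultimately obtain b where b: "bij_betw b (UNIV::'p set) B"
    by (metis finite finite_same_card_bij)
  then have "\<forall>i. \<exists>a. b i = Y *v a"
    using B(1) by (auto simp: bij_betw_def)
  then obtain a where a: "b i = Y *v a i" for i
    by metis
  define A :: "real^'p^'p" where "A = (\<chi> r i. a i $ r)"
  have col: "column i (Y ** A) = b i" for i
    by (simp add: a A_def column_def matrix_matrix_mult_def matrix_vector_mult_def vec_eq_iff)
  have orth: "b i \<bullet> b j = of_bool (i = j)" for i j
  proof (cases "i = j")
    case True
    have "norm (b i) = 1"
      using B(3) b by (auto simp: bij_betw_def)
    with True show ?thesis
      by (simp add: dot_square_norm)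
  next
    case False
    then have "b i \<noteq> b j"
      using b by (auto simp: bij_betw_def inj_on_def)
    moreover have "b i \<in> B" "b j \<in> B"
      using b by (auto simp: bij_betw_def)
    ultimately show ?thesis
      using B(2) False by (auto simp: pairwise_def orthogonal_def)
  qed
  let ?M = "transpose Y ** Y"
  have "transpose (Y ** A) ** (Y ** A) = mat 1"
    by (simp add: matrix_mult_transpose_dot_column col orth mat_def of_bool_def)
  then have 1: "transpose A ** ?M ** A = mat 1"
    by (simp add: matrix_transpose_mul matrix_mul_assoc)
  then have "A ** (transpose A ** ?M) = mat 1"
    using matrix_left_right_inverse by blast
  then have "?M ** (A ** transpose A) = mat 1"
    by (metis matrix_left_right_inverse matrix_mul_assoc)
  moreover have "invertible A"
    using 1 invertible_left_inverse by blast
  ultimately show ?thesis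
    using that by blast
qed

subsection \<open>Generalized least squares\<close>

lemma transpose_zero: "transpose (0 :: real^'n^'m) = 0"
  by (simp add: transpose_def vec_eq_iff)

text \<open>For positive definite \<open>W\<close> the form
  \<open>y \<bullet> (gls_resid X W *v y)\<close> is the minimum over all coefficient vectors of the
  weighted squared error: \<open>W\<close> followed by the removal of the part explained by
  generalized least squares.\<close>

definition gls_resid :: "real^'p^'n \<Rightarrow> real^'n^'n \<Rightarrow> real^'n^'n" where
  "gls_resid X W = W - W ** X ** matrix_inv (transpose X ** W ** X) ** transpose X ** W"

lemma trace_mat_1: "trace (mat 1 :: real^'n^'n) = CARD('n)"
  by (simp add: trace_def mat_def)

context
  fixes X :: "real^'p^'n" and W :: "real^'n^'n"
  assumes W: "transpose W = W" and U: "invertible (transpose X ** W ** X)"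
begin

lemma transpose_gls_info_inv:
  "transpose (matrix_inv (transpose X ** W ** X)) = matrix_inv (transpose X ** W ** X)"
proof (rule matrix_inv_eqI [symmetric])
  let ?U = "transpose X ** W ** X"
  have "?U = transpose ?U"
    by (simp add: W matrix_transpose_mul matrix_mul_assoc)
  then have "?U ** transpose (matrix_inv ?U) = transpose (matrix_inv ?U ** ?U)"
    by (metis matrix_transpose_mul)
  then show "?U ** transpose (matrix_inv ?U) = mat 1"
    by (simp add: matrix_inv_mult U)
qed

lemma transpose_gls_resid: "transpose (gls_resid X W) = gls_resid X W"
  by (simp add: gls_resid_def transpose_diff matrix_transpose_mul W transpose_gls_info_inv matrix_mul_assoc)

lemma gls_resid_mult_design: "gls_resid X W ** X = 0"
proof -
  have "gls_resid X W ** X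
      = W ** X - W ** X ** (matrix_inv (transpose X ** W ** X) ** (transpose X ** W ** X))"
    by (simp add: gls_resid_def matrix_mult_distribs matrix_mul_assoc)
  then show ?thesis
    by (simp add: matrix_inv_mult U)
qed

lemma design_mult_gls_resid: "transpose X ** gls_resid X W = 0"
  by (metis gls_resid_mult_design matrix_transpose_mul transpose_gls_resid transpose_transpose
      transpose_zero)

context
  fixes \<Omega> :: "real^'n^'n"
  assumes \<Omega>: "W ** \<Omega> = mat 1"
begin

lemma gls_resid_mult_cov:
  "gls_resid X W ** \<Omega> = mat 1 - W ** X ** matrix_inv (transpose X ** W ** X) ** transpose X"
proof -
  have "gls_resid X W ** \<Omega>
      = W ** \<Omega> - W ** X ** matrix_inv (transpose X ** W ** X) ** transpose X ** (W ** \<Omega>)"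
    by (simp only: gls_resid_def matrix_mult_distribs matrix_mul_assoc)
  then show ?thesis
    by (simp add: \<Omega>)
qed

text \<open>By cyclicity the subtracted term has the trace of the identity on the coefficient space.
  The difference is the number of residual degrees of freedom, which becomes n - p in the
  prior.\<close>

lemma trace_gls_resid_mult_cov: "trace (gls_resid X W ** \<Omega>) = real CARD('n) - real CARD('p)"
proof -
  have "trace (W ** X ** matrix_inv (transpose X ** W ** X) ** transpose X)
      = trace (matrix_inv (transpose X ** W ** X) ** (transpose X ** W ** X))"
    by (metis matrix_mul_assoc trace_mul_sym)
  then show ?thesis
    by (simp add: gls_resid_mult_cov trace_diff matrix_inv_mult U trace_mat_1)
qed

text \<open>Here \<open>R\<close> is any matrix orthogonal to the design, so that it may be the
  residual matrix of a different weight; the resolvent identity compares two weights.\<close>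

lemma gls_resid_cov_mult:
  assumes "transpose X ** R = 0"
  shows "gls_resid X W ** \<Omega> ** R = R"
proof -
  have "gls_resid X W ** \<Omega> ** R
      = R - W ** X ** matrix_inv (transpose X ** W ** X) ** (transpose X ** R)"
    by (simp add: gls_resid_mult_cov matrix_mult_distribs matrix_mul_assoc)
  then show ?thesis
    by (simp add: assms)
qed

end

text \<open>\<open>b y\<close> is the generalized least squares estimate. The cross terms vanish by
  the normal equations: the weighted residual is \<open>gls_resid X W *v y\<close>, which
  \<open>transpose X\<close> annihilates.\<close>

lemma gls_complete_square:
  defines "b \<equiv> \<lambda>y. (matrix_inv (transpose X ** W ** X) ** transpose X ** W) *v y"
  shows "(y - X *v \<beta>) \<bullet> (W *v (y - X *v \<beta>))
    = y \<bullet> (gls_resid X W *v y) + (\<beta> - b y) \<bullet> ((transpose X ** W ** X) *v (\<beta> - b y))"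
proof -
  define e where "e = y - X *v b y"
  define \<delta> where "\<delta> = \<beta> - b y"
  have y: "y - X *v \<beta> = e - X *v \<delta>"
    by (simp add: e_def \<delta>_def matrix_vector_mult_diff_distrib)
  have We: "W *v e = gls_resid X W *v y"
    by (simp add: e_def b_def gls_resid_def matrix_vector_mult_diff_distrib matrix_vector_mult_diff_rdistrib
        matrix_vector_mul_assoc matrix_mul_assoc)
  have orth: "(X *v v) \<bullet> (W *v e) = 0" for v
  proof -
    have "(X *v v) \<bullet> (W *v e) = (transpose X *v (gls_resid X W *v y)) \<bullet> v"
      unfolding We by (subst inner_commute) (rule inner_matrix_vector_mult)
    also have "\<dots> = 0"
      by (simp only: matrix_vector_mul_assoc design_mult_gls_resid matrix_vector_mult_0 inner_zero_left)
    finally show ?thesis .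
  qed
  have orth': "e \<bullet> (W *v (X *v v)) = 0" for v
    using orth [of v] inner_matrix_vector_mult [of e W "X *v v"] by (simp only: W inner_commute)
  have quad: "(X *v \<delta>) \<bullet> (W *v (X *v \<delta>)) = \<delta> \<bullet> ((transpose X ** W ** X) *v \<delta>)"
  proof -
    have "(X *v \<delta>) \<bullet> (W *v (X *v \<delta>)) = \<delta> \<bullet> (transpose X *v (W *v (X *v \<delta>)))"
      by (simp only: inner_matrix_vector_mult transpose_transpose)
    then show ?thesis
      by (simp only: matrix_vector_mul_assoc matrix_mul_assoc)
  qed
  have "e \<bullet> (W *v e) = y \<bullet> (gls_resid X W *v y)"
    using orth [of "b y"] by (simp add: e_def inner_diff_left We [unfolded e_def])
  then show ?thesis
    unfolding y \<delta>_def [symmetric]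
    by (simp add: matrix_vector_mult_diff_distrib inner_diff_left inner_diff_right orth orth' quad)
qed

end

text \<open>Each residual matrix absorbs the other next to a matching covariance: R1 C1 R2 = R2 and
  R1 C2 R2 = R1, where Ci stands for the i-th covariance. Subtracting gives the identity without
  inverting the singular matrices R1 and R2.\<close>

lemma gls_resid_resolvent:
  fixes X :: "real^'p^'n" and W1 W2 \<Omega>1 \<Omega>2 :: "real^'n^'n"
  assumes 1: "transpose W1 = W1" "invertible (transpose X ** W1 ** X)" "W1 ** \<Omega>1 = mat 1"
    and 2: "transpose W2 = W2" "invertible (transpose X ** W2 ** X)" "W2 ** \<Omega>2 = mat 1"
  shows "gls_resid X W1 - gls_resid X W2 = gls_resid X W1 ** (\<Omega>2 - \<Omega>1) ** gls_resid X W2"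
proof -
  let ?R1 = "gls_resid X W1" and ?R2 = "gls_resid X W2"
  have "?R1 ** \<Omega>1 ** ?R2 = ?R2"
    by (rule gls_resid_cov_mult [OF 1 design_mult_gls_resid [OF 2(1,2)]])
  moreover have "?R1 ** \<Omega>2 ** ?R2 = ?R1"
  proof -
    \<comment> \<open>Absorption is available only for a matrix standing on the right. The mirrored
      version is its transpose, applied to \<open>transpose \<Omega>2\<close> because symmetry of
      the covariance is not among the assumptions.\<close>
    have "W2 ** transpose \<Omega>2 = transpose (\<Omega>2 ** W2)"
      by (simp add: matrix_transpose_mul 2(1))
    also have "\<Omega>2 ** W2 = mat 1"
      using 2(3) matrix_left_right_inverse by blast
    finally have "?R2 ** transpose \<Omega>2 ** ?R1 = ?R1"
      by (intro gls_resid_cov_mult 2(1,2) design_mult_gls_resid [OF 1(1,2)]) simp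
    then have "transpose (?R2 ** transpose \<Omega>2 ** ?R1) = transpose ?R1"
      by simp
    then show ?thesis
      by (simp add: matrix_transpose_mul transpose_gls_resid 1(1,2) 2(1,2) matrix_mul_assoc)
  qed
  ultimately show ?thesis
    by (simp add: matrix_mult_distribs)
qed

lemma matrix_inv_factor_symmetric:
  fixes L :: "real^'n^'n"
  assumes "invertible L"
  shows "transpose (matrix_inv (L ** transpose L)) = matrix_inv (L ** transpose L)"
  by (simp add: matrix_inv_factor [OF assms] matrix_transpose_mul)

text \<open>The information matrix is the Gram matrix of the whitened design
  \<open>matrix_inv L ** X\<close>, which inherits full column rank.\<close>

lemma gls_info_factor:
  fixes X :: "real^'p^'n" and L :: "real^'n^'n"
  assumes X: "inj ((*v) X)" and L: "invertible L"
  defines "U \<equiv> transpose X ** matrix_inv (L ** transpose L) ** X"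
  obtains A :: "real^'p^'p" where "invertible A" "U ** (A ** transpose A) = mat 1"
proof -
  let ?Y = "matrix_inv L ** X"
  have "invertible (matrix_inv L)"
    using L matrix_inv_mult(1) invertible_left_inverse by blast
  then have "inj ((*v) (matrix_inv L))"
    by (rule inj_matrix_vector_mult)
  then have "inj ((*v) ?Y)"
    using X inj_compose by (simp add: matrix_vector_mult_matrix_matrix_mult_compose)
  moreover have "transpose ?Y ** ?Y = U"
    by (simp add: U_def matrix_inv_factor [OF L] matrix_transpose_mul matrix_mul_assoc)
  ultimately show ?thesis
    using inverse_gram_factor [of ?Y] that by metis
qed

lemma gls_info_det_pos:
  fixes X :: "real^'p^'n" and L :: "real^'n^'n"
  assumes "inj ((*v) X)" and "invertible L"
  shows "0 < det (transpose X ** matrix_inv (L ** transpose L) ** X)"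
proof -
  obtain A :: "real^'p^'p" where A: "transpose X ** matrix_inv (L ** transpose L) ** X ** (A ** transpose A) = mat 1"
    using gls_info_factor [OF assms] by blast
  then have "det (transpose X ** matrix_inv (L ** transpose L) ** X) * (det A)\<^sup>2 = 1"
    by (metis det_I det_mul det_transpose power2_eq_square)
  then have "0 < det (transpose X ** matrix_inv (L ** transpose L) ** X) * (det A)\<^sup>2"
    by simp
  then show ?thesis
    by (simp add: zero_less_mult_iff)
qed

text \<open>After completing the square, the integrand is a constant times a Gaussian density in the
  coefficient vector, centered at the least squares estimate with the inverse information as
  covariance. That density integrates to 1, so the integral is the ratio of normalizing constants
  times the residual exponential.\<close>

lemma gaussian_density_integral_location:
  fixes X :: "real^'p^'n" and L :: "real^'n^'n"
  assumes X: "inj ((*v) X)" and L: "invertible L"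
  defines "S \<equiv> L ** transpose L"
  defines "W \<equiv> matrix_inv S"
  shows "has_bochner_integral lborel (\<lambda>\<beta>. gaussian_density (X *v \<beta>) S y)
    (sqrt ((2 * pi) ^ CARD('p) / ((2 * pi) ^ CARD('n) * det S * det (transpose X ** W ** X)))
      * exp (- (y \<bullet> (gls_resid X W *v y)) / 2))"
proof -
  let ?U = "transpose X ** W ** X"
  obtain A :: "real^'p^'p" where A: "invertible A" "?U ** (A ** transpose A) = mat 1"
    unfolding W_def S_def using gls_info_factor [OF X L] by blast
  have U: "invertible ?U"
    using A(2) invertible_right_inverse by blast
  have W: "transpose W = W"
    unfolding W_def S_def by (rule matrix_inv_factor_symmetric [OF L])
  have inv: "matrix_inv (A ** transpose A) = ?U"
    using A(2) matrix_inv_eqI matrix_left_right_inverse by blast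
  have "det ?U * det (A ** transpose A) = 1"
    by (metis A(2) det_I det_mul)
  then have det: "det (A ** transpose A) = 1 / det ?U"
    by (metis mult_zero_left nonzero_eq_divide_eq mult.commute zero_neq_one)
  have pos: "0 < det ?U"
    unfolding W_def S_def by (rule gls_info_det_pos [OF X L])
  let ?b = "(matrix_inv ?U ** transpose X ** W) *v y"
  define K where "K = sqrt ((2 * pi) ^ CARD('p) / ((2 * pi) ^ CARD('n) * det S * det ?U))
      * exp (- (y \<bullet> (gls_resid X W *v y)) / 2)"
  have eq: "gaussian_density (X *v \<beta>) S y
      = K * gaussian_density ?b (A ** transpose A) \<beta>" for \<beta>
  proof -
    have sq: "(y - X *v \<beta>) \<bullet> (W *v (y - X *v \<beta>))
        = y \<bullet> (gls_resid X W *v y) + (\<beta> - ?b) \<bullet> (?U *v (\<beta> - ?b))"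
      by (rule gls_complete_square [OF W U])
    have "gaussian_density (X *v \<beta>) S y = exp (- (y \<bullet> (gls_resid X W *v y)) / 2)
        * exp (- ((\<beta> - ?b) \<bullet> (?U *v (\<beta> - ?b))) / 2) / sqrt ((2 * pi) ^ CARD('n) * det S)"
      unfolding gaussian_density_def W_def [symmetric] sq
      by (simp add: exp_add [symmetric] add_divide_distrib)
    then show ?thesis
      unfolding gaussian_density_def inv det K_def using pos
      by (simp add: real_sqrt_mult real_sqrt_divide field_simps del: power_mult_distrib)
  qed
  have "has_bochner_integral lborel (\<lambda>\<beta>. K * gaussian_density ?b (A ** transpose A) \<beta>) (K * 1)"
    by (intro has_bochner_integral_mult_right has_bochner_integral_gaussian_density A(1))
  then show ?thesis
    unfolding eq K_def [symmetric] by (simp only: mult_1_right)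
qed

subsection \<open>Hessians and Fisher information\<close>

lemma has_derivative_comp_nth:
  fixes z :: "real^'n"
  assumes "(\<phi> has_real_derivative D) (at (z $ k))"
  shows "((\<lambda>z. \<phi> (z $ k)) has_derivative (\<lambda>h. D * h $ k)) (at z)"
proof -
  have "((\<lambda>z. z $ k) has_derivative (\<lambda>h. h $ k)) (at z)"
    by (intro bounded_linear_imp_has_derivative bounded_linear_vec_nth)
  moreover have "(\<phi> has_derivative (*) D) (at (z $ k))"
    using assms by (simp add: has_field_derivative_def)
  ultimately show ?thesis
    by (rule has_derivative_compose)
qed

text \<open>Separates the two parameters: the variance enters only through a logarithm and a
  reciprocal, so derivatives of functions of one variable suffice. The formula for \<open>f\<close>
  is asked for on the positive quadrant; that set is open, so the gradient is known near the point,
  as \<open>has_hessian\<close> demands.\<close>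

lemma has_hessian_profile:
  fixes \<theta> :: "real^2"
  assumes pos: "0 < \<theta> $ 1" "0 < \<theta> $ 2"
    and a: "\<And>t. 0 < t \<Longrightarrow> (a has_real_derivative a1 t) (at t)"
    and a1: "\<And>t. 0 < t \<Longrightarrow> (a1 has_real_derivative a2 t) (at t)"
    and r: "\<And>t. 0 < t \<Longrightarrow> (r has_real_derivative r1 t) (at t)"
    and r1: "\<And>t. 0 < t \<Longrightarrow> (r1 has_real_derivative r2 t) (at t)"
    and f: "\<And>z. 0 < z $ 1 \<Longrightarrow> 0 < z $ 2 \<Longrightarrow> f z = C - m / 2 * ln (z $ 1) + a (z $ 2) - r (z $ 2) / (2 * z $ 1)"
  shows "has_hessian f
    (vector [vector [m / (2 * (\<theta> $ 1)\<^sup>2) - r (\<theta> $ 2) / (\<theta> $ 1) ^ 3, r1 (\<theta> $ 2) / (2 * (\<theta> $ 1)\<^sup>2)],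
             vector [r1 (\<theta> $ 2) / (2 * (\<theta> $ 1)\<^sup>2), a2 (\<theta> $ 2) - r2 (\<theta> $ 2) / (2 * \<theta> $ 1)]]) \<theta>"
proof -
  let ?Q = "{z::real^2. 0 < z $ 1 \<and> 0 < z $ 2}"
  have op: "open ?Q"
    by (intro open_Collect_conj open_Collect_less continuous_intros)
  have nth: "((\<lambda>z::real^2. z $ k) has_derivative (\<lambda>h. h $ k)) (at z)" for k z
    by (intro bounded_linear_imp_has_derivative bounded_linear_vec_nth)
  let ?g1 = "\<lambda>z::real^2. - m / (2 * z $ 1) + r (z $ 2) / (2 * (z $ 1)\<^sup>2)"
  let ?g2 = "\<lambda>z::real^2. a1 (z $ 2) - r1 (z $ 2) / (2 * z $ 1)"
  let ?g = "\<lambda>z. ?g1 z *\<^sub>R axis 1 1 + ?g2 z *\<^sub>R axis 2 1 :: real^2"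
  have inner: "h \<bullet> ?g z = h $ 1 * ?g1 z + h $ 2 * ?g2 z" for h z
    by (simp add: inner_add_right inner_axis)
  have G: "GDERIV f z :> ?g z" if z: "z \<in> ?Q" for z
  proof -
    have "((\<lambda>z. C - m / 2 * ln (z $ 1) + a (z $ 2) - r (z $ 2) / (2 * z $ 1)) has_derivative
        (\<lambda>h. h \<bullet> ?g z)) (at z)"
      unfolding inner using z
      by (auto intro!: derivative_eq_intros nth has_derivative_comp_nth [OF a] has_derivative_comp_nth [OF r]
          simp: fun_eq_iff field_simps power2_eq_square)
    then show ?thesis
      unfolding gderiv_def
      by (rule has_derivative_transform_within_open [OF _ op z]) (simp add: f)
  qed
  have "eventually (\<lambda>z. z \<in> ?Q) (nhds \<theta>)"
    using op pos by (intro eventually_nhds_in_open) auto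
  then have ev: "eventually (\<lambda>z. GDERIV f z :> ?g z) (nhds \<theta>)"
    by eventually_elim (rule G)
  let ?A = "vector [vector [m / (2 * (\<theta> $ 1)\<^sup>2) - r (\<theta> $ 2) / (\<theta> $ 1) ^ 3, r1 (\<theta> $ 2) / (2 * (\<theta> $ 1)\<^sup>2)],
             vector [r1 (\<theta> $ 2) / (2 * (\<theta> $ 1)\<^sup>2), a2 (\<theta> $ 2) - r2 (\<theta> $ 2) / (2 * \<theta> $ 1)]] :: real^2^2"
  have g1: "(?g1 has_derivative (\<lambda>h. (?A *v h) $ 1)) (at \<theta>)"
    using pos
    by (auto intro!: derivative_eq_intros nth has_derivative_comp_nth [OF r]
        simp: fun_eq_iff field_simps power2_eq_square power3_eq_cube matrix_vector_mult_def sum_2)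
  have g2: "(?g2 has_derivative (\<lambda>h. (?A *v h) $ 2)) (at \<theta>)"
    using pos
    by (auto intro!: derivative_eq_intros nth has_derivative_comp_nth [OF a1] has_derivative_comp_nth [OF r1]
        simp: fun_eq_iff field_simps power2_eq_square matrix_vector_mult_def sum_2)
  have "(?g has_derivative (\<lambda>h. (?A *v h) $ 1 *\<^sub>R axis 1 1 + (?A *v h) $ 2 *\<^sub>R (axis 2 1 :: real^2))) (at \<theta>)"
    by (intro has_derivative_add has_derivative_scaleR_left g1 g2)
  moreover have "w $ 1 *\<^sub>R axis 1 1 + w $ 2 *\<^sub>R axis 2 1 = w" for w :: "real^2"
    by (simp add: vec_eq_iff forall_2 axis_def)
  ultimately have "(?g has_derivative (\<lambda>h. ?A *v h)) (at \<theta>)"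
    by simp
  with ev show ?thesis
    unfolding has_hessian_def by (intro exI [of _ ?g] conjI)
qed

lemma has_hessian_unique:
  assumes "has_hessian f A \<theta>" "has_hessian f B \<theta>"
  shows "A = B"
proof -
  obtain g h where g: "eventually (\<lambda>z. GDERIV f z :> g z) (nhds \<theta>)" "(g has_derivative (\<lambda>v. A *v v)) (at \<theta>)"
    and h: "eventually (\<lambda>z. GDERIV f z :> h z) (nhds \<theta>)" "(h has_derivative (\<lambda>v. B *v v)) (at \<theta>)"
    using assms unfolding has_hessian_def by blast
  have "eventually (\<lambda>z. g z = h z) (nhds \<theta>)"
    using g(1) h(1)
  proof eventually_elim
    case (elim z)
    then have "(\<lambda>v. v \<bullet> g z) = (\<lambda>v. v \<bullet> h z)"
      unfolding gderiv_def by (rule has_derivative_unique)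
    then have "\<forall>v. v \<bullet> g z = v \<bullet> h z"
      by (rule fun_cong [THEN allI])
    then show ?case
      by (simp add: vector_eq_ldot)
  qed
  then obtain S where "open S" "\<theta> \<in> S" "\<And>z. z \<in> S \<Longrightarrow> g z = h z"
    by (auto simp: eventually_nhds)
  with g(2) have "(h has_derivative (\<lambda>v. A *v v)) (at \<theta>)"
    by (rule has_derivative_transform_within_open)
  then have "(\<lambda>v. A *v v) = (\<lambda>v. B *v v)"
    using h(2) by (rule has_derivative_unique)
  then show ?thesis
    by (simp add: matrix_eq fun_eq_iff)
qed

text \<open>\<open>is_reference_prior\<close> asserts only that some information matrix exists.
  Uniqueness identifies it with the computed one when the form of a given prior has to be
  derived.\<close>

lemma has_fisher_information_unique:
  assumes "has_fisher_information l M J \<theta>" "has_fisher_information l M J' \<theta>"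
  shows "J = J'"
proof -
  obtain A B where A: "\<And>y. has_hessian (\<lambda>z. l z y) (A y) \<theta>" "has_bochner_integral M (\<lambda>y. - A y) J"
    and B: "\<And>y. has_hessian (\<lambda>z. l z y) (B y) \<theta>" "has_bochner_integral M (\<lambda>y. - B y) J'"
    using assms unfolding has_fisher_information_def by blast
  have "A = B"
    using has_hessian_unique [OF A(1) B(1)] by (rule ext)
  with A(2) B(2) show ?thesis
    using has_bochner_integral_eq by blast
qed

subsection \<open>The ICAR model\<close>

text \<open>Rescaling the weights does not change the least squares fit, so the residual matrix
  scales linearly. This pulls the variance out of every matrix expression.\<close>

lemma gls_resid_scaleR:
  fixes X :: "real^'p^'n"
  assumes "invertible (transpose X ** W ** X)" "c \<noteq> 0"
  shows "gls_resid X (c *\<^sub>R W) = c *\<^sub>R gls_resid X W"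
proof -
  have "matrix_inv (transpose X ** (c *\<^sub>R W) ** X) = (1 / c) *\<^sub>R matrix_inv (transpose X ** W ** X)"
    using assms by (intro matrix_inv_eqI) (simp add: matrix_mult_distribs matrix_inv_mult)
  then show ?thesis
    using assms(2) by (simp add: gls_resid_def matrix_mult_distribs scaleR_diff_right)
qed

lemma diag_matrix_mult: "diag_matrix a ** diag_matrix b = diag_matrix (\<lambda>i. a i * b i)"
  by (simp add: diag_matrix_def matrix_matrix_mult_def vec_eq_iff if_distrib [of "\<lambda>x. x * y" for y] cong: if_cong)

lemma transpose_diag_matrix: "transpose (diag_matrix a) = diag_matrix a"
  by (auto simp: diag_matrix_def transpose_def vec_eq_iff)

lemma diag_matrix_scaleR: "c *\<^sub>R diag_matrix a = diag_matrix (\<lambda>i. c * a i)"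
  by (simp add: diag_matrix_def vec_eq_iff)

lemma det_diag_matrix: "det (diag_matrix a) = (\<Prod>i\<in>UNIV. a i)"
  by (subst det_diagonal) (auto simp: diag_matrix_def)

text \<open>Nonnegative eigenvalues \<open>e\<close> make the covariance positive definite for every
  positive ratio parameter, even though \<open>G\<close> is singular in the application. There
  \<open>e\<close> holds the reciprocals of the eigenvalues of the neighborhood matrix, with 0 kept
  at the null eigenvalue.\<close>

locale icar_model =
  fixes X :: "real^'p^'n" and P :: "real^'n^'n" and e :: "'n \<Rightarrow> real" and G :: "real^'n^'n"
  assumes inj_X: "inj ((*v) X)" and P: "orthogonal_matrix P" and e_nonneg: "0 \<le> e i"
    and G_def: "G = P ** diag_matrix e ** transpose P"
begin

definition cov :: "real \<Rightarrow> real^'n^'n" where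
  "cov t = mat 1 + (1 / t) *\<^sub>R G"

definition prec :: "real \<Rightarrow> real^'n^'n" where
  "prec t = matrix_inv (cov t)"

definition info :: "real \<Rightarrow> real^'p^'p" where
  "info t = transpose X ** prec t ** X"

definition resid :: "real \<Rightarrow> real^'n^'n" where
  "resid t = gls_resid X (prec t)"

text \<open>An explicit, generally non-symmetric square root of the covariance: the eigenvectors
  scaled by the roots of the eigenvalues, in the form needed for whitening.\<close>

definition cov_factor :: "real \<Rightarrow> real \<Rightarrow> real^'n^'n" where
  "cov_factor v t = P ** diag_matrix (\<lambda>i. sqrt (v * (1 + e i / t)))"

lemma cov_diag: "cov t = P ** diag_matrix (\<lambda>i. 1 + e i / t) ** transpose P"
proof -
  have "diag_matrix (\<lambda>i. 1 + e i / t) = mat 1 + (1 / t) *\<^sub>R diag_matrix e"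
    by (simp add: diag_matrix_def mat_def vec_eq_iff)
  then show ?thesis
    unfolding cov_def using P by (simp add: G_def matrix_mult_distribs orthogonal_matrix_def)
qed

lemma cov_entry_pos: "0 < t \<Longrightarrow> 0 < 1 + e i / t"
  using e_nonneg [of i] by (simp add: add_pos_nonneg)

lemma cov_factor:
  assumes "0 < v" "0 < t"
  shows "invertible (cov_factor v t)" "cov_factor v t ** transpose (cov_factor v t) = v *\<^sub>R cov t"
proof -
  have "det P \<noteq> 0"
    using P by (metis invertible_det_nz invertible_def orthogonal_matrix_def)
  moreover have "det (diag_matrix (\<lambda>i. sqrt (v * (1 + e i / t)))) \<noteq> 0"
    using assms cov_entry_pos by (auto simp: det_diag_matrix) (metis less_irrefl)
  ultimately show "invertible (cov_factor v t)"
    by (simp add: cov_factor_def invertible_det_nz det_mul)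
  have "cov_factor v t ** transpose (cov_factor v t)
      = P ** (diag_matrix (\<lambda>i. sqrt (v * (1 + e i / t))) ** diag_matrix (\<lambda>i. sqrt (v * (1 + e i / t)))) ** transpose P"
    by (simp only: cov_factor_def matrix_transpose_mul transpose_diag_matrix matrix_mul_assoc)
  also have "diag_matrix (\<lambda>i. sqrt (v * (1 + e i / t))) ** diag_matrix (\<lambda>i. sqrt (v * (1 + e i / t)))
      = v *\<^sub>R diag_matrix (\<lambda>i. 1 + e i / t)"
    using assms cov_entry_pos by (simp add: diag_matrix_mult diag_matrix_scaleR less_imp_le)
  finally show "cov_factor v t ** transpose (cov_factor v t) = v *\<^sub>R cov t"
    by (simp add: cov_diag matrix_mult_distribs)
qed

lemma
  assumes t: "0 < t"
  shows prec_cov: "prec t ** cov t = mat 1" and cov_prec: "cov t ** prec t = mat 1"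
    and transpose_prec: "transpose (prec t) = prec t"
    and det_cov_pos: "0 < det (cov t)" and det_info_pos: "0 < det (info t)"
proof -
  let ?L = "cov_factor 1 t"
  have L: "invertible ?L" and LL: "?L ** transpose ?L = cov t"
    using cov_factor [of 1 t] t by simp_all
  have inv: "invertible (cov t)"
    unfolding LL [symmetric] by (intro invertible_mult L transpose_invertible)
  then show "prec t ** cov t = mat 1" "cov t ** prec t = mat 1"
    by (simp_all add: prec_def matrix_inv_mult)
  show "transpose (prec t) = prec t"
    using matrix_inv_factor_symmetric [OF L] by (simp add: LL prec_def)
  have "det (cov t) = (det ?L)\<^sup>2"
    by (simp add: LL [symmetric] det_mul power2_eq_square)
  then show "0 < det (cov t)"
    using L by (simp add: invertible_det_nz)
  show "0 < det (info t)"
    using gls_info_det_pos [OF inj_X L] by (simp add: LL info_def prec_def)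
qed

lemma invertible_info: "0 < t \<Longrightarrow> invertible (info t)"
  using det_info_pos [of t] by (simp add: invertible_det_nz)

lemmas invertible_info' = invertible_info [unfolded info_def]

lemma cov_diff: "cov t - cov s = (1 / t - 1 / s) *\<^sub>R G"
  by (simp add: cov_def scaleR_diff_left)

lemma resid_mult_design: "0 < t \<Longrightarrow> resid t ** X = 0"
  unfolding resid_def by (rule gls_resid_mult_design [OF transpose_prec invertible_info'])

lemma resid_cov_resid: "0 < t \<Longrightarrow> resid t ** cov t ** resid t = resid t"
  unfolding resid_def
  by (rule gls_resid_cov_mult [OF transpose_prec invertible_info' prec_cov
        design_mult_gls_resid [OF transpose_prec invertible_info']])

lemma trace_resid_cov: "0 < t \<Longrightarrow> trace (resid t ** cov t) = real CARD('n) - real CARD('p)"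
  unfolding resid_def by (rule trace_gls_resid_mult_cov [OF transpose_prec invertible_info' prec_cov])

lemma prec_has_vector_derivative:
  "0 < t \<Longrightarrow> (prec has_vector_derivative (1 / t\<^sup>2) *\<^sub>R (prec t ** G ** prec t)) (at t)"
proof (rule resolvent_has_vector_derivative)
  fix s t :: real
  assume s: "0 < s" and t: "0 < t"
  have "(1 / t - 1 / s) *\<^sub>R (prec s ** G ** prec t) = prec s ** (cov t - cov s) ** prec t"
    by (simp add: cov_diff matrix_mult_distribs)
  also have "\<dots> = prec s ** (cov t ** prec t) - (prec s ** cov s) ** prec t"
    by (simp add: matrix_mult_distribs matrix_mul_assoc)
  also have "\<dots> = prec s - prec t"
    by (simp add: cov_prec prec_cov s t)
  finally show "prec s - prec t = (1 / t - 1 / s) *\<^sub>R (prec s ** G ** prec t)" ..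
qed

lemma resid_has_vector_derivative:
  "0 < t \<Longrightarrow> (resid has_vector_derivative (1 / t\<^sup>2) *\<^sub>R (resid t ** G ** resid t)) (at t)"
proof (rule resolvent_has_vector_derivative)
  fix s t :: real
  assume s: "0 < s" and t: "0 < t"
  have "resid s - resid t = resid s ** (cov t - cov s) ** resid t"
    unfolding resid_def
    by (rule gls_resid_resolvent [OF transpose_prec [OF s] invertible_info' [OF s] prec_cov [OF s]
          transpose_prec [OF t] invertible_info' [OF t] prec_cov [OF t]])
  then show "resid s - resid t = (1 / t - 1 / s) *\<^sub>R (resid s ** G ** resid t)"
    by (simp add: cov_diff matrix_mult_distribs)
qed

section \<open>Derivatives with respect to the ratio parameter\<close>

definition k1 :: "real \<Rightarrow> real" where
  "k1 t = trace (G ** resid t)"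

definition k2 :: "real \<Rightarrow> real" where
  "k2 t = trace (G ** resid t ** G ** resid t)"

lemma k1_derivative:
  assumes "0 < t"
  shows "(k1 has_real_derivative k2 t / t\<^sup>2) (at t)"
proof -
  have "bounded_linear (\<lambda>A. trace (G ** A))"
    by (rule bounded_linear_compose [OF bounded_linear_trace
          bounded_bilinear.bounded_linear_right [OF bounded_bilinear_matrix_mult]])
  then have "((\<lambda>t. trace (G ** resid t)) has_vector_derivative
      trace (G ** ((1 / t\<^sup>2) *\<^sub>R (resid t ** G ** resid t)))) (at t)"
    by (rule bounded_linear.has_vector_derivative [OF _ resid_has_vector_derivative [OF assms]])
  then show ?thesis
    by (simp add: has_real_derivative_iff_has_vector_derivative k1_def [abs_def] k2_def
        matrix_mult_distribs trace_scaleR matrix_mul_assoc)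
qed

text \<open>As \<open>t\<close> grows, \<open>cov t\<close> shrinks and \<open>info t\<close> grows,
  so the two logarithms have derivatives of opposite sign. By cyclicity the contribution of
  \<open>info t\<close> is exactly the correction that turns \<open>prec t\<close> into
  \<open>resid t\<close> under the trace with \<open>G\<close>.\<close>

lemma log_det_derivative:
  assumes t: "0 < t"
  shows "((\<lambda>t. - ln (det (cov t)) / 2 - ln (det (info t)) / 2) has_real_derivative k1 t / (2 * t\<^sup>2)) (at t)"
proof -
  have "((\<lambda>t. 1 / t) has_real_derivative - (1 / t\<^sup>2)) (at t)"
    using t by (auto intro!: derivative_eq_intros simp: power2_eq_square)
  from has_vector_derivative_add [OF has_vector_derivative_const
      has_vector_derivative_scaleR [OF this has_vector_derivative_const]]
  have "(cov has_vector_derivative (- (1 / t\<^sup>2)) *\<^sub>R G) (at t)"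
    by (simp add: cov_def [abs_def])
  from has_real_derivative_ln_det [OF this det_cov_pos [OF t]]
  have 1: "((\<lambda>t. ln (det (cov t))) has_real_derivative - (trace (prec t ** G) / t\<^sup>2)) (at t)"
    by (simp only: prec_def [symmetric] matrix_mult_distribs trace_scaleR) simp
  have "bounded_linear (\<lambda>A. transpose X ** A ** X)"
    by (rule bounded_linear_compose [OF bounded_bilinear.bounded_linear_left [OF bounded_bilinear_matrix_mult]
          bounded_bilinear.bounded_linear_right [OF bounded_bilinear_matrix_mult]])
  then have "((\<lambda>t. transpose X ** prec t ** X) has_vector_derivative
      transpose X ** ((1 / t\<^sup>2) *\<^sub>R (prec t ** G ** prec t)) ** X) (at t)"
    by (rule bounded_linear.has_vector_derivative [OF _ prec_has_vector_derivative [OF t]])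
  then have "(info has_vector_derivative
      (1 / t\<^sup>2) *\<^sub>R (transpose X ** prec t ** G ** prec t ** X)) (at t)"
    by (simp add: info_def [abs_def] matrix_mult_distribs matrix_mul_assoc)
  from has_real_derivative_ln_det [OF this det_info_pos [OF t]]
  have 2: "((\<lambda>t. ln (det (info t))) has_real_derivative
      trace (matrix_inv (info t) ** (transpose X ** prec t ** G ** prec t ** X)) / t\<^sup>2) (at t)"
    by (simp add: matrix_mult_distribs trace_scaleR)
  have "trace (G ** (prec t ** X ** matrix_inv (info t) ** transpose X ** prec t))
      = trace ((G ** prec t ** X) ** (matrix_inv (info t) ** transpose X ** prec t))"
    by (simp add: matrix_mul_assoc)
  also have "\<dots> = trace ((matrix_inv (info t) ** transpose X ** prec t) ** (G ** prec t ** X))"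
    by (rule trace_mul_sym)
  finally have "k1 t = trace (prec t ** G)
      - trace (matrix_inv (info t) ** (transpose X ** prec t ** G ** prec t ** X))"
    by (simp add: k1_def resid_def gls_resid_def info_def matrix_mult_distribs trace_diff
        trace_mul_sym [of "prec t" G] matrix_mul_assoc)
  then show ?thesis
    using t by (intro DERIV_cong [OF DERIV_diff [OF DERIV_cdivide [OF DERIV_minus [OF 1]] DERIV_cdivide [OF 2]]])
      (simp add: field_simps)
qed

lemma quadratic_form_derivative:
  fixes F :: "real \<Rightarrow> real^'n^'n"
  assumes "(F has_vector_derivative F') (at t)"
  shows "((\<lambda>t. y \<bullet> (F t *v y)) has_real_derivative y \<bullet> (F' *v y)) (at t)"
proof -
  have "linear (\<lambda>A. y \<bullet> (A *v y))"
    by (rule linearI) (simp_all add: matrix_vector_mult_add_rdistrib inner_add_right scaleR_matrix_vector_assoc [symmetric])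
  then show ?thesis
    unfolding has_real_derivative_iff_has_vector_derivative
    by (intro bounded_linear.has_vector_derivative [OF _ assms]) (simp add: linear_conv_bounded_linear)
qed

lemma resid_G_resid_derivative:
  assumes t: "0 < t"
  shows "((\<lambda>t. (1 / t\<^sup>2) *\<^sub>R (resid t ** G ** resid t)) has_vector_derivative
    (- 2 / t ^ 3) *\<^sub>R (resid t ** G ** resid t)
    + (2 / t ^ 4) *\<^sub>R (resid t ** G ** resid t ** G ** resid t)) (at t)"
proof -
  note R = resid_has_vector_derivative [OF t]
  have "((\<lambda>t. resid t ** G) has_vector_derivative ((1 / t\<^sup>2) *\<^sub>R (resid t ** G ** resid t)) ** G) (at t)"
    by (rule bounded_linear.has_vector_derivative
        [OF bounded_bilinear.bounded_linear_left [OF bounded_bilinear_matrix_mult] R])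
  from bounded_bilinear.has_vector_derivative [OF bounded_bilinear_matrix_mult this R]
  \<comment> \<open>The factor 2 arises because differentiating either outer factor produces the
    same word.\<close>
  have D: "((\<lambda>t. resid t ** G ** resid t) has_vector_derivative
      (2 / t\<^sup>2) *\<^sub>R (resid t ** G ** resid t ** G ** resid t)) (at t)"
    by (simp add: matrix_mult_distribs matrix_mul_assoc scaleR_2 [symmetric])
  have "((\<lambda>t. 1 / t\<^sup>2) has_real_derivative - 2 / t ^ 3) (at t)"
    using t by (auto intro!: derivative_eq_intros simp: field_simps power2_eq_square power3_eq_cube)
  from has_vector_derivative_scaleR [OF this D] show ?thesis
    by (simp add: power2_eq_square power4_eq_xxxx add.commute mult.assoc)
qed

section \<open>Integrated likelihood and its Fisher information\<close>

lemma icar_density_integral: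
  assumes v: "0 < z $ 1" and t: "0 < z $ 2"
  shows "has_bochner_integral lborel (\<lambda>\<beta>. icar_density X G \<beta> z y)
    (sqrt ((2 * pi) ^ CARD('p) / ((2 * pi) ^ CARD('n) * ((z $ 1) ^ CARD('n) * det (cov (z $ 2)))
        * ((1 / z $ 1) ^ CARD('p) * det (info (z $ 2)))))
      * exp (- (y \<bullet> (resid (z $ 2) *v y)) / (2 * z $ 1)))"
proof -
  let ?v = "z $ 1" and ?t = "z $ 2"
  note L = cov_factor [OF v t]
  have S: "?v *\<^sub>R (mat 1 + (1 / ?t) *\<^sub>R G) = cov_factor ?v ?t ** transpose (cov_factor ?v ?t)"
    by (simp add: L(2) cov_def)
  \<comment> \<open>The variance is isolated here: the covariance determinant carries its n-th power
    and the information determinant its power -p, which leaves the exponent -(n-p)/2 in the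
    integrated likelihood.\<close>
  have W: "matrix_inv (cov_factor ?v ?t ** transpose (cov_factor ?v ?t)) = (1 / ?v) *\<^sub>R prec ?t"
    unfolding L(2) using v t by (intro matrix_inv_eqI) (simp add: matrix_mult_distribs cov_prec)
  have R: "gls_resid X ((1 / ?v) *\<^sub>R prec ?t) = (1 / ?v) *\<^sub>R resid ?t"
    unfolding resid_def using v by (intro gls_resid_scaleR invertible_info' [OF t]) simp
  have U: "transpose X ** ((1 / ?v) *\<^sub>R prec ?t) ** X = (1 / ?v) *\<^sub>R info ?t"
    by (simp add: info_def matrix_mult_distribs)
  have E: "y \<bullet> ((1 / ?v) *\<^sub>R resid ?t *v y) = (y \<bullet> (resid ?t *v y)) / ?v"
    by (simp add: scaleR_matrix_vector_assoc [symmetric])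
  have "(\<lambda>\<beta>. icar_density X G \<beta> z y)
      = (\<lambda>\<beta>. gaussian_density (X *v \<beta>) (cov_factor ?v ?t ** transpose (cov_factor ?v ?t)) y)"
    unfolding icar_density_def S ..
  with gaussian_density_integral_location [OF inj_X L(1), of y] show ?thesis
    unfolding W R U E unfolding L(2) det_scaleR by (simp add: mult.commute)
qed

lemma log_integrated_likelihood:
  assumes v: "0 < z $ 1" and t: "0 < z $ 2"
  shows "ln (integrated_likelihood (icar_density X G) z y)
    = (real CARD('p) - real CARD('n)) * ln (2 * pi) / 2
      - (real CARD('n) - real CARD('p)) / 2 * ln (z $ 1)
      + (- ln (det (cov (z $ 2))) / 2 - ln (det (info (z $ 2))) / 2)
      - (y \<bullet> (resid (z $ 2) *v y)) / (2 * z $ 1)"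
proof -
  have c: "0 < det (cov (z $ 2))" and i: "0 < det (info (z $ 2))"
    using det_cov_pos det_info_pos t by blast+
  show ?thesis
    unfolding integrated_likelihood_def
      has_bochner_integral_integral_eq [OF icar_density_integral [OF v t]]
    using v c i
    by (simp add: ln_mult ln_sqrt ln_div ln_realpow field_simps del: power_mult_distrib)
qed

text \<open>The condition \<open>M ** X = 0\<close> removes the mean from the quadratic form, which
  is why the information does not depend on the coefficient vector. The total mass 1 is what
  integrates the constant entries of the Hessian.\<close>

lemma icar_density_expectations:
  assumes v: "0 < \<theta> $ 1" and t: "0 < \<theta> $ 2"
  defines "N \<equiv> \<lambda>\<beta>. density lborel (\<lambda>y. ennreal (icar_density X G \<beta> \<theta> y))"
  shows "has_bochner_integral (N \<beta>) (\<lambda>y. 1 :: real) 1"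
    and "M ** X = 0 \<Longrightarrow> has_bochner_integral (N \<beta>) (\<lambda>y. y \<bullet> (M *v y)) (\<theta> $ 1 * trace (M ** cov (\<theta> $ 2)))"
proof -
  note L = cov_factor [OF v t]
  have S: "icar_density X G \<beta> \<theta>
      = gaussian_density (X *v \<beta>) (cov_factor (\<theta> $ 1) (\<theta> $ 2) ** transpose (cov_factor (\<theta> $ 1) (\<theta> $ 2)))"
    by (simp add: icar_density_def L(2) cov_def)
  show "has_bochner_integral (N \<beta>) (\<lambda>y. 1 :: real) 1"
    unfolding N_def S
    by (rule has_bochner_integral_density)
       (simp_all add: gaussian_density_nonneg has_bochner_integral_gaussian_density L(1))
  assume M: "M ** X = 0"
  have "(X *v \<beta>) \<bullet> (M *v (X *v \<beta>)) = 0"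
    by (simp add: matrix_vector_mul_assoc M)
  then show "has_bochner_integral (N \<beta>) (\<lambda>y. y \<bullet> (M *v y)) (\<theta> $ 1 * trace (M ** cov (\<theta> $ 2)))"
    using gaussian_quadratic_expectation [OF L(1), of "X *v \<beta>" M] unfolding N_def S
    by (simp add: L(2) matrix_mult_distribs trace_scaleR)
qed

definition fisher :: "real^2 \<Rightarrow> real^2^2" where
  "fisher \<theta> = vector
    [vector [(real CARD('n) - real CARD('p)) / (2 * (\<theta> $ 1)\<^sup>2), - k1 (\<theta> $ 2) / (2 * \<theta> $ 1 * (\<theta> $ 2)\<^sup>2)],
     vector [- k1 (\<theta> $ 2) / (2 * \<theta> $ 1 * (\<theta> $ 2)\<^sup>2), k2 (\<theta> $ 2) / (2 * (\<theta> $ 2) ^ 4)]]"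

text \<open>In the lower right entry the \<open>k1\<close> terms cancel between the determinants and
  the expected quadratic form, and \<open>k2\<close> changes its factor from -1/2 to -1/2 + 1. In
  the upper left entry, likewise, -m/2 + m leaves m/2.\<close>

lemma has_fisher_information_fisher:
  assumes v: "0 < \<theta> $ 1" and t: "0 < \<theta> $ 2"
  shows "has_fisher_information (\<lambda>z y. ln (integrated_likelihood (icar_density X G) z y))
    (density lborel (\<lambda>y. ennreal (icar_density X G \<beta> \<theta> y))) (fisher \<theta>) \<theta>"
proof -
  define m where "m = real CARD('n) - real CARD('p)"
  define V T where "V = \<theta> $ 1" and "T = \<theta> $ 2"
  have V: "0 < V" and T: "0 < T"
    using v t by (simp_all add: V_def T_def)
  define r1 where "r1 t = (1 / t\<^sup>2) *\<^sub>R (resid t ** G ** resid t)" for t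
  define r2 where "r2 t = (- 2 / t ^ 3) *\<^sub>R (resid t ** G ** resid t)
    + (2 / t ^ 4) *\<^sub>R (resid t ** G ** resid t ** G ** resid t)" for t
  define a2 where "a2 t = k2 t / (2 * t ^ 4) - k1 t / t ^ 3" for t
  define A :: "real^'n \<Rightarrow> real^2^2" where "A y = vector
     [vector [m / (2 * V\<^sup>2) - (y \<bullet> (resid T *v y)) / V ^ 3, (y \<bullet> (r1 T *v y)) / (2 * V\<^sup>2)],
      vector [(y \<bullet> (r1 T *v y)) / (2 * V\<^sup>2), a2 T - (y \<bullet> (r2 T *v y)) / (2 * V)]]" for y
  have hess: "has_hessian (\<lambda>z. ln (integrated_likelihood (icar_density X G) z y)) (A y) \<theta>" for y
    unfolding A_def V_def T_def
  proof (rule has_hessian_profile [OF v t, where C = "(real CARD('p) - real CARD('n)) * ln (2 * pi) / 2"])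
    fix t :: real
    assume t: "0 < t"
    show "((\<lambda>t. - ln (det (cov t)) / 2 - ln (det (info t)) / 2) has_real_derivative k1 t / (2 * t\<^sup>2)) (at t)"
      by (rule log_det_derivative [OF t])
    show "((\<lambda>t. k1 t / (2 * t\<^sup>2)) has_real_derivative a2 t) (at t)"
      using t by (auto intro!: derivative_eq_intros k1_derivative
          simp: a2_def field_simps power2_eq_square power3_eq_cube power4_eq_xxxx)
    show "((\<lambda>t. y \<bullet> (resid t *v y)) has_real_derivative y \<bullet> (r1 t *v y)) (at t)"
      unfolding r1_def by (rule quadratic_form_derivative [OF resid_has_vector_derivative [OF t]])
    show "((\<lambda>t. y \<bullet> (r1 t *v y)) has_real_derivative y \<bullet> (r2 t *v y)) (at t)"
      unfolding r1_def r2_def by (rule quadratic_form_derivative [OF resid_G_resid_derivative [OF t]])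
  qed (simp add: log_integrated_likelihood m_def)
  let ?N = "density lborel (\<lambda>y. ennreal (icar_density X G \<beta> \<theta> y))"
  note ex = icar_density_expectations [OF v t, where \<beta> = \<beta>, folded V_def T_def]
  have kill: "resid T ** X = 0" "M ** resid T ** X = 0" for M :: "real^'n^'n"
    using resid_mult_design [OF T] by (simp_all add: matrix_mul_assoc [symmetric])
  \<comment> \<open>Cycling the trace brings \<open>resid T ** cov T ** resid T\<close> together,
    which collapses to \<open>resid T\<close>.\<close>
  have tr: "trace (resid T ** M ** resid T ** cov T) = trace (M ** resid T)" for M
    by (metis T matrix_mul_assoc resid_cov_resid trace_mul_sym)
  have tr1: "trace (resid T ** G ** resid T ** cov T) = k1 T"
    by (simp add: tr k1_def)
  have tr2: "trace (resid T ** G ** resid T ** G ** resid T ** cov T) = k2 T"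
    using tr [of "G ** resid T ** G"] by (simp add: k2_def matrix_mul_assoc)
  have e0: "has_bochner_integral ?N (\<lambda>y. y \<bullet> (resid T *v y)) (V * m)"
    using ex(2) [OF kill(1)] by (simp add: trace_resid_cov T m_def)
  have e1: "has_bochner_integral ?N (\<lambda>y. y \<bullet> (r1 T *v y)) (V * (k1 T / T\<^sup>2))"
    using ex(2) [of "r1 T"] by (simp add: r1_def matrix_mult_distribs kill trace_scaleR tr1)
  have e2: "has_bochner_integral ?N (\<lambda>y. y \<bullet> (r2 T *v y)) (V * (- 2 / T ^ 3 * k1 T + 2 / T ^ 4 * k2 T))"
    using ex(2) [of "r2 T"]
    by (simp add: r2_def matrix_mult_distribs kill trace_add trace_scaleR tr1 tr2 del: scaleR_minus_left)
  \<comment> \<open>Minus the Hessian is an affine combination of three scalar quadratic forms in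
    \<open>y\<close> with constant matrix coefficients, so its matrix-valued expectation reduces to
    scalar ones.\<close>
  define K0 K1 K2 K3 :: "real^2^2"
    where "K0 = vector [vector [- m / (2 * V\<^sup>2), 0], vector [0, - a2 T]]"
      and "K1 = vector [vector [1 / V ^ 3, 0], vector [0, 0]]"
      and "K2 = vector [vector [0, - 1 / (2 * V\<^sup>2)], vector [- 1 / (2 * V\<^sup>2), 0]]"
      and "K3 = vector [vector [0, 0], vector [0, 1 / (2 * V)]]"
  note K = K0_def K1_def K2_def K3_def
  have "has_bochner_integral ?N
      (\<lambda>y. 1 *\<^sub>R K0 + (y \<bullet> (resid T *v y)) *\<^sub>R K1 + (y \<bullet> (r1 T *v y)) *\<^sub>R K2 + (y \<bullet> (r2 T *v y)) *\<^sub>R K3)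
      (1 *\<^sub>R K0 + (V * m) *\<^sub>R K1 + (V * (k1 T / T\<^sup>2)) *\<^sub>R K2
        + (V * (- 2 / T ^ 3 * k1 T + 2 / T ^ 4 * k2 T)) *\<^sub>R K3)"
    by (intro has_bochner_integral_add has_bochner_integral_scaleR_left e0 e1 e2 ex(1))
  moreover have "1 *\<^sub>R K0 + (y \<bullet> (resid T *v y)) *\<^sub>R K1 + (y \<bullet> (r1 T *v y)) *\<^sub>R K2
      + (y \<bullet> (r2 T *v y)) *\<^sub>R K3 = - A y" for y
    by (simp add: A_def K vec_eq_iff forall_2 vector_def)
  moreover have "1 *\<^sub>R K0 + (V * m) *\<^sub>R K1 + (V * (k1 T / T\<^sup>2)) *\<^sub>R K2
        + (V * (- 2 / T ^ 3 * k1 T + 2 / T ^ 4 * k2 T)) *\<^sub>R K3 = fisher \<theta>"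
    unfolding fisher_def V_def [symmetric] T_def [symmetric] m_def [symmetric] using V T
    by (simp add: K a2_def vec_eq_iff forall_2 vector_def field_simps power2_eq_square power3_eq_cube power4_eq_xxxx)
  ultimately have "has_bochner_integral ?N (\<lambda>y. - A y) (fisher \<theta>)"
    by simp
  with hess show ?thesis
    unfolding has_fisher_information_def by blast
qed

end

section \<open>The Moore-Penrose inverse in spectral form\<close>

lemma is_moore_penrose_inverse_unique:
  fixes A :: "real^'n^'m"
  assumes B: "is_moore_penrose_inverse A B" and C: "is_moore_penrose_inverse A C"
  shows "B = C"
proof -
  note B = B [unfolded is_moore_penrose_inverse_def] and C = C [unfolded is_moore_penrose_inverse_def]
  have t: "transpose (A ** B) = A ** B" "transpose (B ** A) = B ** A"
    "transpose (A ** C) = A ** C" "transpose (C ** A) = C ** A"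
    using B C by auto
  \<comment> \<open>Both \<open>A ** B\<close> and \<open>A ** C\<close> are orthogonal projections
    onto the range of \<open>A\<close>, hence equal; the symmetry conditions allow the factors to be
    exchanged. The same argument on the other side compares \<open>B ** A\<close> with
    \<open>C ** A\<close>.\<close>
  have "A ** B = (A ** C ** A) ** B"
    using C by simp
  also have "\<dots> = transpose (A ** C) ** transpose (A ** B)"
    by (simp only: t matrix_mul_assoc)
  also have "\<dots> = transpose ((A ** B ** A) ** C)"
    by (simp only: matrix_transpose_mul [symmetric] matrix_mul_assoc)
  also have "\<dots> = A ** C"
    using B C by simp
  finally have 1: "A ** B = A ** C" .
  have "B ** A = B ** (A ** C ** A)"
    using C by simp
  also have "\<dots> = transpose (B ** A) ** transpose (C ** A)"
    by (simp only: t matrix_mul_assoc)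
  also have "\<dots> = transpose (C ** (A ** B ** A))"
    by (simp only: matrix_transpose_mul [symmetric] matrix_mul_assoc)
  also have "\<dots> = C ** A"
    using B C by simp
  finally have 2: "B ** A = C ** A" .
  have "B = (B ** A) ** B"
    using B by simp
  also have "\<dots> = C ** (A ** B)"
    by (simp only: 2 matrix_mul_assoc)
  also have "\<dots> = C"
    using C by (simp add: 1 matrix_mul_assoc)
  finally show ?thesis .
qed

text \<open>Matrices diagonal in the basis \<open>P\<close> multiply eigenvalue by eigenvalue, so
  the Penrose conditions become scalar identities. They also hold at a zero eigenvalue, by the
  convention \<open>inverse 0 = 0\<close>.\<close>

lemma is_moore_penrose_inverse_spectral:
  fixes P :: "real^'n^'n"
  assumes P: "orthogonal_matrix P"
  shows "is_moore_penrose_inverse (P ** diag_matrix a ** transpose P)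
    (P ** diag_matrix (\<lambda>i. inverse (a i)) ** transpose P)"
proof -
  have PP: "transpose P ** P = mat 1"
    using P by (simp add: orthogonal_matrix_def)
  have mult: "(P ** diag_matrix b ** transpose P) ** (P ** diag_matrix c ** transpose P)
      = P ** diag_matrix (\<lambda>i. b i * c i) ** transpose P" for b c
  proof -
    have "(P ** diag_matrix b ** transpose P) ** (P ** diag_matrix c ** transpose P)
        = P ** diag_matrix b ** (transpose P ** P) ** diag_matrix c ** transpose P"
      by (simp only: matrix_mul_assoc)
    also have "\<dots> = P ** (diag_matrix b ** diag_matrix c) ** transpose P"
      by (simp add: PP matrix_mul_assoc)
    finally show ?thesis
      by (simp only: diag_matrix_mult)
  qed
  have sym: "transpose (P ** diag_matrix b ** transpose P) = P ** diag_matrix b ** transpose P" for b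
    by (simp add: matrix_transpose_mul transpose_diag_matrix matrix_mul_assoc)
  have "a i * inverse (a i) * a i = a i" "inverse (a i) * a i * inverse (a i) = inverse (a i)" for i
    by (cases "a i = 0"; simp)+
  then show ?thesis
    unfolding is_moore_penrose_inverse_def by (simp only: mult sym)
qed

section \<open>Traces in spectral coordinates\<close>

context icar_model
begin

text \<open>Conjugation by \<open>P\<close> turns the precision into \<open>B\<close> and the design
  into \<open>Y\<close>, and so the residual matrix into the one built from them. The commutation
  serves to reorder words: the traces produce alternating products of \<open>B\<close> and
  \<open>D\<close>, whereas the Q matrices collect all powers of \<open>D\<close> in front.\<close>

lemma spectral_resid:
  fixes D B :: "real^'n^'n" and Y :: "real^'p^'n"
  assumes t: "0 < t" and D: "D = diag_matrix e" and Y: "Y = transpose P ** X"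
    and B: "B = matrix_inv (mat 1 + (1 / t) *\<^sub>R D)"
  shows "transpose P ** resid t ** P
      = B - B ** Y ** matrix_inv (transpose Y ** B ** Y) ** transpose Y ** B"
    and "D ** B = B ** D"
proof -
  have PP: "transpose P ** P = mat 1" "P ** transpose P = mat 1"
    using P by (simp_all add: orthogonal_matrix_def)
  have X: "P ** Y = X"
    by (simp add: Y matrix_mul_assoc PP)
  let ?E = "mat 1 + (1 / t) *\<^sub>R D"
  have E: "?E = diag_matrix (\<lambda>i. 1 + e i / t)"
    by (simp add: D diag_matrix_def mat_def vec_eq_iff)
  have "1 + e i / t \<noteq> 0" for i
    using cov_entry_pos [OF t, of i] by simp
  then have "det ?E \<noteq> 0"
    by (simp add: E det_diag_matrix)
  then have inv: "invertible ?E"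
    by (simp add: invertible_det_nz)
  have EB: "?E ** B = mat 1" "B ** ?E = mat 1"
    by (simp_all only: B matrix_inv_mult [OF inv])
  have "cov t ** (P ** B ** transpose P) = P ** ?E ** (transpose P ** P) ** B ** transpose P"
    by (simp only: cov_diag E matrix_mul_assoc)
  also have "\<dots> = P ** (?E ** B) ** transpose P"
    by (simp only: PP matrix_mul_rid matrix_mul_assoc)
  finally have "cov t ** (P ** B ** transpose P) = mat 1"
    by (simp only: EB PP matrix_mul_rid)
  then have prec: "prec t = P ** B ** transpose P"
    unfolding prec_def by (rule matrix_inv_eqI)
  have PpP: "transpose P ** prec t ** P = (transpose P ** P) ** B ** (transpose P ** P)"
    by (simp only: prec matrix_mul_assoc)
  have "transpose P ** prec t ** X = transpose P ** prec t ** P ** Y"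
    by (simp only: X matrix_mul_assoc [symmetric])
  then have PpX: "transpose P ** prec t ** X = B ** Y"
    by (simp only: PpP PP matrix_mul_lid matrix_mul_rid)
  have XY: "transpose X = transpose Y ** transpose P"
    by (simp only: X [symmetric] matrix_transpose_mul)
  have "transpose X ** prec t ** P = transpose Y ** (transpose P ** prec t ** P)"
    by (simp only: XY matrix_mul_assoc)
  then have XpP: "transpose X ** prec t ** P = transpose Y ** B"
    by (simp only: PpP PP matrix_mul_lid matrix_mul_rid)
  have "info t = transpose Y ** (transpose P ** prec t ** X)"
    by (simp only: info_def XY matrix_mul_assoc)
  then have info: "info t = transpose Y ** B ** Y"
    by (simp only: PpX matrix_mul_assoc)
  have "resid t = prec t - prec t ** X ** matrix_inv (info t) ** transpose X ** prec t"
    by (simp only: resid_def gls_resid_def info_def)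
  then have "transpose P ** resid t ** P = transpose P ** prec t ** P
      - (transpose P ** prec t ** X) ** matrix_inv (info t) ** (transpose X ** prec t ** P)"
    by (simp only: matrix_mult_distribs matrix_mul_assoc)
  then show "transpose P ** resid t ** P
      = B - B ** Y ** matrix_inv (transpose Y ** B ** Y) ** transpose Y ** B"
    by (simp only: PpP PpX XpP PP info matrix_mul_lid matrix_mul_rid matrix_mul_assoc)
  have DE: "D ** ?E = ?E ** D"
    unfolding E by (simp add: D diag_matrix_mult mult.commute)
  have "D ** B = B ** ?E ** D ** B"
    by (simp only: EB matrix_mul_lid)
  also have "\<dots> = B ** (?E ** D) ** B"
    by (simp only: matrix_mul_assoc)
  also have "\<dots> = B ** D ** (?E ** B)"
    by (simp only: DE [symmetric] matrix_mul_assoc)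
  also have "\<dots> = B ** D"
    by (simp only: EB matrix_mul_rid)
  finally show "D ** B = B ** D" .
qed

text \<open>In spectral coordinates \<open>G ** resid t\<close> becomes \<open>D ** R\<close>, which
  is \<open>D ** B t\<close> minus a correction through the design. The trace of its square has two
  cross terms, equal by cyclicity and hence the factor 2, and the squared correction cycles into the
  square of the product of the inverse of Q01 with Q12.\<close>

lemma spectral_traces:
  fixes D :: "real^'n^'n" and Y :: "real^'p^'n" and B :: "real \<Rightarrow> real^'n^'n"
  assumes t: "0 < t" and D: "D = diag_matrix e" and Y: "Y = transpose P ** X"
    and B: "\<And>t. B t = matrix_inv (mat 1 + (1 / t) *\<^sub>R D)"
    and Q: "\<And>i j t. Q i j t = transpose Y ** matrix_pow D i ** matrix_pow (B t) j ** Y"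
  shows "k1 t = trace (D ** B t) - trace (matrix_inv (Q 0 1 t) ** Q 1 2 t)"
    and "k2 t = trace (matrix_pow (D ** B t) 2) + trace (matrix_pow (matrix_inv (Q 0 1 t) ** Q 1 2 t) 2)
      - 2 * trace (matrix_inv (Q 0 1 t) ** Q 2 3 t)"
proof -
  note spec = spectral_resid [OF t D Y B]
  let ?B = "B t"
  define q where "q = matrix_inv (transpose Y ** ?B ** Y)"
  define R where "R = ?B - ?B ** Y ** q ** transpose Y ** ?B"
  have R: "transpose P ** resid t ** P = R"
    unfolding R_def q_def by (rule spec(1))
  have com: "D ** ?B = ?B ** D" "M ** D ** ?B = M ** ?B ** D" for M :: "real^'n^'m"
    using spec(2) by (simp_all add: matrix_mul_assoc [symmetric])
  have q: "matrix_inv (Q 0 1 t) = q"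
    by (simp add: Q q_def)
  have Q12: "Q 1 2 t = transpose Y ** ?B ** D ** ?B ** Y"
    by (simp add: Q numeral_2_eq_2 matrix_mul_assoc com)
  have Q23: "Q 2 3 t = transpose Y ** ?B ** D ** ?B ** D ** ?B ** Y"
    by (simp add: Q numeral_2_eq_2 numeral_3_eq_3 matrix_mul_assoc com)
  have DR: "D ** R = D ** ?B - D ** ?B ** Y ** q ** transpose Y ** ?B"
    by (simp add: R_def matrix_mult_distribs matrix_mul_assoc)
  have GM: "trace (G ** M) = trace (D ** (transpose P ** M ** P))" for M
  proof -
    have "trace (G ** M) = trace (P ** (D ** transpose P ** M))"
      by (simp only: G_def D matrix_mul_assoc)
    also have "\<dots> = trace (D ** transpose P ** M ** P)"
      by (rule trace_mul_sym)
    finally show ?thesis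
      by (simp only: matrix_mul_assoc)
  qed
  have "k1 t = trace (D ** R)"
    by (simp only: k1_def GM R)
  moreover have tr: "trace (M ** Y ** q ** transpose Y ** ?B) = trace (q ** (transpose Y ** ?B ** M ** Y))" for M
  proof -
    have "trace (M ** Y ** q ** transpose Y ** ?B) = trace ((M ** Y) ** (q ** transpose Y ** ?B))"
      by (simp add: matrix_mul_assoc)
    also have "\<dots> = trace (q ** transpose Y ** ?B ** (M ** Y))"
      by (rule trace_mul_sym)
    finally show ?thesis
      by (simp add: matrix_mul_assoc)
  qed
  ultimately show "k1 t = trace (D ** B t) - trace (matrix_inv (Q 0 1 t) ** Q 1 2 t)"
    by (simp only: DR trace_diff tr q Q12 matrix_mul_assoc)
  have "transpose P ** (resid t ** G ** resid t) ** P = (transpose P ** resid t ** P) ** D ** (transpose P ** resid t ** P)"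
    by (simp only: G_def D matrix_mul_assoc)
  then have "k2 t = trace (D ** R ** (D ** R))"
    using GM [of "resid t ** G ** resid t"] by (simp only: k2_def R matrix_mul_assoc)
  also have "\<dots> = trace (D ** ?B ** (D ** ?B))
      - trace (D ** ?B ** D ** ?B ** Y ** q ** transpose Y ** ?B)
      - trace (D ** ?B ** Y ** q ** transpose Y ** ?B ** (D ** ?B))
      + trace (D ** ?B ** Y ** q ** transpose Y ** ?B ** D ** ?B ** Y ** q ** transpose Y ** ?B)"
    by (simp add: DR matrix_mult_distribs trace_diff matrix_mul_assoc)
  also have "trace (D ** ?B ** Y ** q ** transpose Y ** ?B ** (D ** ?B))
      = trace (D ** ?B ** D ** ?B ** Y ** q ** transpose Y ** ?B)"
    by (subst trace_mul_sym) (simp add: matrix_mul_assoc)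
  also have "trace (D ** ?B ** D ** ?B ** Y ** q ** transpose Y ** ?B) = trace (q ** Q 2 3 t)"
    by (simp add: tr Q23 matrix_mul_assoc)
  also have "trace (D ** ?B ** Y ** q ** transpose Y ** ?B ** D ** ?B ** Y ** q ** transpose Y ** ?B)
      = trace (q ** Q 1 2 t ** (q ** Q 1 2 t))"
    using tr [of "D ** ?B ** Y ** q ** transpose Y ** ?B ** D ** ?B"]
    by (simp only: Q12 matrix_mul_assoc)
  finally show "k2 t = trace (matrix_pow (D ** B t) 2) + trace (matrix_pow (matrix_inv (Q 0 1 t) ** Q 1 2 t) 2)
      - 2 * trace (matrix_inv (Q 0 1 t) ** Q 2 3 t)"
    by (simp only: q numeral_2_eq_2 matrix_pow.simps matrix_mul_rid)
qed

section \<open>Determinant of the information and the resulting priors\<close>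

lemma sqrt_det_fisher:
  assumes "CARD('p) < CARD('n)" "0 < \<theta> $ 1" "0 < \<theta> $ 2"
  shows "sqrt (det (fisher \<theta>)) = sqrt (real CARD('n) - real CARD('p)) / 2 * ((1 / \<theta> $ 1) * ((1 / (\<theta> $ 2)\<^sup>2)
    * sqrt (k2 (\<theta> $ 2) - 1 / (real CARD('n) - real CARD('p)) * (k1 (\<theta> $ 2))\<^sup>2)))"
proof -
  define m where "m = real CARD('n) - real CARD('p)"
  have m: "0 < m"
    using assms(1) by (simp add: m_def)
  \<comment> \<open>Factoring m = n - p out of m \<open>k2\<close> - \<open>k1\<close>^2 creates the
    coefficient 1/(n-p). Since \<open>sqrt\<close> is multiplicative on all reals, the root can then
    be split whatever the sign of the radicand.\<close>
  have "det (fisher \<theta>) = m * (1 / (2 * \<theta> $ 1 * (\<theta> $ 2)\<^sup>2))\<^sup>2 * (k2 (\<theta> $ 2) - 1 / m * (k1 (\<theta> $ 2))\<^sup>2)"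
    using m assms(2,3)
    by (simp add: fisher_def det_2 m_def [symmetric] field_simps power2_eq_square power4_eq_xxxx)
  then show ?thesis
    unfolding m_def [symmetric] using assms(2,3) by (simp add: real_sqrt_mult)
qed

text \<open>One direction replaces the unknown information matrix by \<open>fisher\<close>, by
  uniqueness; the other supplies \<open>fisher\<close> as the witness, together with integrability
  of the density in the coefficient vector.\<close>

lemma is_reference_prior_iff:
  "is_reference_prior {\<theta>. 0 < \<theta> $ 1 \<and> 0 < \<theta> $ 2} (icar_density X G) \<pi>
    \<longleftrightarrow> (\<exists>c>0. \<forall>\<beta> \<theta>. 0 < \<theta> $ 1 \<longrightarrow> 0 < \<theta> $ 2 \<longrightarrow> \<pi> \<beta> \<theta> = c * sqrt (det (fisher \<theta>)))"
    (is "?L \<longleftrightarrow> ?R")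
proof
  assume ?L
  then obtain J c where *: "\<forall>\<theta>\<in>{\<theta>. 0 < \<theta> $ 1 \<and> 0 < \<theta> $ 2}. \<forall>\<beta>.
      has_fisher_information (\<lambda>z y. ln (integrated_likelihood (icar_density X G) z y))
        (density lborel (\<lambda>y. ennreal (icar_density X G \<beta> \<theta> y))) (J \<theta>) \<theta>"
    and c: "c > 0" "\<forall>\<beta>. \<forall>\<theta>\<in>{\<theta>. 0 < \<theta> $ 1 \<and> 0 < \<theta> $ 2}. \<pi> \<beta> \<theta> = 1 * (c * sqrt (det (J \<theta>)))"
    unfolding is_reference_prior_def by blast
  have J: "has_fisher_information (\<lambda>z y. ln (integrated_likelihood (icar_density X G) z y))
        (density lborel (\<lambda>y. ennreal (icar_density X G \<beta> \<theta> y))) (J \<theta>) \<theta>"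
    if "0 < \<theta> $ 1" "0 < \<theta> $ 2" for \<theta> \<beta>
    using * that by blast
  have "J \<theta> = fisher \<theta>" if "0 < \<theta> $ 1" "0 < \<theta> $ 2" for \<theta>
    using J [OF that] has_fisher_information_fisher [OF that] by (rule has_fisher_information_unique)
  with c show ?R
    by auto
next
  assume ?R
  then obtain c where "c > 0"
    "\<And>\<beta> \<theta>. 0 < \<theta> $ 1 \<Longrightarrow> 0 < \<theta> $ 2 \<Longrightarrow> \<pi> \<beta> \<theta> = c * sqrt (det (fisher \<theta>))"
    by blast
  then show ?L
    unfolding is_reference_prior_def
    using has_fisher_information_fisher integrable.intros [OF icar_density_integral]
    by (intro conjI exI [of _ fisher] exI [of _ c] ballI allI) simp_all
qed

end

theorem theorem4p1:
  fixes N :: "'n::{finite,linorder} \<Rightarrow> 'n set"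
    and g :: "'n::{finite,linorder} \<Rightarrow> 'n \<Rightarrow> real"
    and H Hp P Dp :: "real^'n::{finite,linorder}^'n::{finite,linorder}"
    and d :: "'n::{finite,linorder} \<Rightarrow> real"
    and X Xt :: "real^'p^'n::{finite,linorder}"
    and B :: "real \<Rightarrow> real^'n::{finite,linorder}^'n::{finite,linorder}"
    and Q :: "nat \<Rightarrow> nat \<Rightarrow> real \<Rightarrow> real^'p^'p"
    and prior :: "real^'p \<Rightarrow> real \<Rightarrow> real \<Rightarrow> real"
  assumes neighbors_sym: "\<And>i j. i \<in> N j \<longleftrightarrow> j \<in> N i"
    and neighbors_irrefl: "\<And>j. j \<notin> N j"
    and connected: "\<And>i j. (i, j) \<in> {(a, b). a \<in> N b}\<^sup>*"
    and weights_sym: "\<And>i j. g i j = g j i"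
    and weights_nonneg: "\<And>i j. 0 \<le> g i j"
    and weights_zero: "\<And>i j. i \<noteq> j \<Longrightarrow> i \<notin> N j \<Longrightarrow> g i j = 0"
    and H: "H = neighborhood_matrix N g"
    and Hp: "is_moore_penrose_inverse H Hp"
    and full_column_rank: "rank X = CARD('p)"
    and p_less_n: "CARD('p) < CARD('n)"
    and intercept: "\<exists>k. column k X = 1"
    and P: "orthogonal_matrix P"
    and spectral: "H = P ** diag_matrix d ** transpose P"
    and d_sorted: "\<And>i j. i \<le> j \<Longrightarrow> d j \<le> d i"
    and d_last: "d (Max UNIV) = 0"
    and d_pos: "\<And>i. i \<noteq> Max UNIV \<Longrightarrow> 0 < d i"
    and Dp: "Dp = diag_matrix (\<lambda>i. if i = Max UNIV then 0 else 1 / d i)"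
    and Xt: "Xt = transpose P ** X"
    and B: "\<And>\<tau>. B \<tau> = matrix_inv (mat 1 + (1 / \<tau>) *\<^sub>R Dp)"
    and Q: "\<And>i j \<tau>. Q i j \<tau> = transpose Xt ** matrix_pow Dp i ** matrix_pow (B \<tau>) j ** Xt"
  shows "is_reference_prior {\<theta>. 0 < \<theta> $ 1 \<and> 0 < \<theta> $ 2} (icar_density X Hp)
           (\<lambda>\<beta> \<theta>. prior \<beta> (\<theta> $ 1) (\<theta> $ 2))
     \<longleftrightarrow>
     (\<exists>prior\<^sub>\<tau>.
        (\<exists>c>0. \<forall>\<beta>. \<forall>\<sigma>2>0. \<forall>\<tau>>0. prior \<beta> \<sigma>2 \<tau> = c * ((1 / \<sigma>2) * prior\<^sub>\<tau> \<tau>)) \<and>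
        (\<exists>c>0. \<forall>\<tau>>0. prior\<^sub>\<tau> \<tau> = c * ((1 / \<tau>\<^sup>2) * sqrt (
             trace (matrix_pow (Dp ** B \<tau>) 2)
           + trace (matrix_pow (matrix_inv (Q 0 1 \<tau>) ** Q 1 2 \<tau>) 2)
           - 2 * trace (matrix_inv (Q 0 1 \<tau>) ** Q 2 3 \<tau>)
           - 1 / (real CARD('n) - real CARD('p))
               * (trace (matrix_inv (Q 0 1 \<tau>) ** Q 1 2 \<tau>) - trace (Dp ** B \<tau>))\<^sup>2))))"
proof -
  \<comment> \<open>The index \<open>Max UNIV\<close> stands for n. There \<open>d\<close> is 0 and
    so is its \<open>inverse\<close>, hence \<open>e\<close> is the diagonal of \<open>Dp\<close>
    and no case distinction enters the spectral form of \<open>Hp\<close>.\<close>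
  define e where "e i = inverse (d i)" for i
  have e: "e = (\<lambda>i. if i = Max UNIV then 0 else 1 / d i)"
    using d_last by (auto simp: e_def fun_eq_iff inverse_eq_divide)
  have Hp_eq: "Hp = P ** diag_matrix e ** transpose P"
    using is_moore_penrose_inverse_unique [OF Hp]
      is_moore_penrose_inverse_spectral [OF P, of d] unfolding spectral e_def by blast
  interpret icar_model X P e Hp
  proof
    show "inj ((*v) X)"
      using full_column_rank by (simp add: full_rank_injective)
    show "0 \<le> e i" for i
      using d_pos [of i] by (simp add: e less_imp_le)
  qed (fact P Hp_eq)+
  define m where "m = real CARD('n) - real CARD('p)"
  define h where "h \<tau> = (1 / \<tau>\<^sup>2) * sqrt (
             trace (matrix_pow (Dp ** B \<tau>) 2)
           + trace (matrix_pow (matrix_inv (Q 0 1 \<tau>) ** Q 1 2 \<tau>) 2)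
           - 2 * trace (matrix_inv (Q 0 1 \<tau>) ** Q 2 3 \<tau>)
           - 1 / m * (trace (matrix_inv (Q 0 1 \<tau>) ** Q 1 2 \<tau>) - trace (Dp ** B \<tau>))\<^sup>2)" for \<tau>
  have m: "0 < m"
    using p_less_n by (simp add: m_def)
  have D: "Dp = diag_matrix e"
    by (simp only: Dp e)
  have tr:
    "k1 \<tau> = trace (Dp ** B \<tau>) - trace (matrix_inv (Q 0 1 \<tau>) ** Q 1 2 \<tau>)"
    "k2 \<tau> = trace (matrix_pow (Dp ** B \<tau>) 2) + trace (matrix_pow (matrix_inv (Q 0 1 \<tau>) ** Q 1 2 \<tau>) 2)
      - 2 * trace (matrix_inv (Q 0 1 \<tau>) ** Q 2 3 \<tau>)" if "0 < \<tau>" for \<tau>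
    by (rule spectral_traces [OF that D Xt B Q])+
  have det: "sqrt (det (fisher \<theta>)) = sqrt m / 2 * ((1 / \<theta> $ 1) * h (\<theta> $ 2))"
    if "0 < \<theta> $ 1" "0 < \<theta> $ 2" for \<theta>
    unfolding sqrt_det_fisher [OF p_less_n that] h_def tr [OF that(2)] m_def [symmetric]
    by (simp only: power2_commute)
  let ?L = "is_reference_prior {\<theta>. 0 < \<theta> $ 1 \<and> 0 < \<theta> $ 2} (icar_density X Hp) (\<lambda>\<beta> \<theta>. prior \<beta> (\<theta> $ 1) (\<theta> $ 2))"
  have "?L \<longleftrightarrow> (\<exists>c>0. \<forall>\<beta>. \<forall>\<sigma>2>0. \<forall>\<tau>>0. prior \<beta> \<sigma>2 \<tau> = c * ((1 / \<sigma>2) * h \<tau>))"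
  proof
    assume ?L
    then obtain c where c: "c > 0" "\<And>\<beta> \<theta>. 0 < \<theta> $ 1 \<Longrightarrow> 0 < \<theta> $ 2 \<Longrightarrow>
        prior \<beta> (\<theta> $ 1) (\<theta> $ 2) = c * sqrt (det (fisher \<theta>))"
      unfolding is_reference_prior_iff by blast
    \<comment> \<open>The factor \<open>sqrt m / 2\<close> is the constant left over from the
      determinant; the converse direction divides by it.\<close>
    have "prior \<beta> \<sigma>2 \<tau> = (c * (sqrt m / 2)) * ((1 / \<sigma>2) * h \<tau>)" if "0 < \<sigma>2" "0 < \<tau>" for \<beta> \<sigma>2 \<tau>
      using c(2) [of "vector [\<sigma>2, \<tau>]" \<beta>] det [of "vector [\<sigma>2, \<tau>]"] that by (simp add: vector_2)
    then show "\<exists>c>0. \<forall>\<beta>. \<forall>\<sigma>2>0. \<forall>\<tau>>0. prior \<beta> \<sigma>2 \<tau> = c * ((1 / \<sigma>2) * h \<tau>)"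
      using c(1) m by (intro exI [of _ "c * (sqrt m / 2)"]) simp
  next
    assume "\<exists>c>0. \<forall>\<beta>. \<forall>\<sigma>2>0. \<forall>\<tau>>0. prior \<beta> \<sigma>2 \<tau> = c * ((1 / \<sigma>2) * h \<tau>)"
    then obtain c where c: "c > 0" "\<And>\<beta> \<sigma>2 \<tau>. 0 < \<sigma>2 \<Longrightarrow> 0 < \<tau> \<Longrightarrow> prior \<beta> \<sigma>2 \<tau> = c * ((1 / \<sigma>2) * h \<tau>)"
      by blast
    then show ?L
      unfolding is_reference_prior_iff using m
      by (intro exI [of _ "c * 2 / sqrt m"]) (simp add: det)
  qed
  \<comment> \<open>The marginal prior is itself fixed only up to a constant. One direction takes
    \<open>h\<close> with constant 1, the other multiplies the two constants.\<close>
  also have "\<dots> \<longleftrightarrow> (\<exists>prior\<^sub>\<tau>.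
        (\<exists>c>0. \<forall>\<beta>. \<forall>\<sigma>2>0. \<forall>\<tau>>0. prior \<beta> \<sigma>2 \<tau> = c * ((1 / \<sigma>2) * prior\<^sub>\<tau> \<tau>)) \<and>
        (\<exists>c>0. \<forall>\<tau>>0. prior\<^sub>\<tau> \<tau> = c * h \<tau>))" (is "?A \<longleftrightarrow> ?B")
  proof
    assume ?A
    then show ?B
      by (intro exI [of _ h]) (auto intro: exI [of _ 1])
  next
    assume ?B
    then obtain p where p: "(\<exists>c>0. \<forall>\<beta>. \<forall>\<sigma>2>0. \<forall>\<tau>>0. prior \<beta> \<sigma>2 \<tau> = c * ((1 / \<sigma>2) * p \<tau>)) \<and>
        (\<exists>c>0. \<forall>\<tau>>0. p \<tau> = c * h \<tau>)"
      by (rule exE)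
    from conjunct1 [OF p] obtain c where c: "c > 0" "\<forall>\<beta>. \<forall>\<sigma>2>0. \<forall>\<tau>>0. prior \<beta> \<sigma>2 \<tau> = c * ((1 / \<sigma>2) * p \<tau>)"
      by (elim exE conjE)
    from conjunct2 [OF p] obtain c' where c': "c' > 0" "\<forall>\<tau>>0. p \<tau> = c' * h \<tau>"
      by (elim exE conjE)
    have "prior \<beta> \<sigma>2 \<tau> = c * c' * ((1 / \<sigma>2) * h \<tau>)" if "0 < \<sigma>2" "0 < \<tau>" for \<beta> \<sigma>2 \<tau>
      using c(2) c'(2) that by simp
    with c(1) c'(1) show ?A
      by (intro exI [of _ "c * c'"]) simp
  qed
  finally show ?thesis
    unfolding h_def m_def .
qed

end
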